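(* Let $\Gamma$ be a discrete group. Assume that $\Gamma$ has property $(RD)$. If $C^{\ast}_r(\Gamma)$ has no nontrivial idempotents, then for every $p\in[1,\infty]$, $B^p_r(\Gamma)$ has no nontrivial idempotents.
   Context: An idempotent in a unital Banach algebra $A$ is an element $a\in A$ with $a^2=a$; it is nontrivial if it is neither $0$ nor the unit element $I$. For a discrete group $\Gamma$, $\mathbb{C}\Gamma$ is the group algebra of finitely supported functions $f=\sum_{\alpha\in\Gamma}f_\alpha\alpha$ on $\Gamma$ with the convolution product. For $p\in[1,\infty]$, the left regular representation $\lambda:\Gamma\to\mathcal{B}(\ell^p(\Gamma))$ is $(\lambda(\gamma)\xi)(\alpha)=\xi(\gamma^{-1}\alpha)$, and for $f\in\mathbb{C}\Gamma$ one sets $\|f\|_{\mathcal{B}(\ell^p(\Gamma))}:=\|\sum_{\alpha}f_\alpha\lambda(\alpha)\|$ (operator norm on $\ell^p(\Gamma)$). The reduced group $\ell^p$-operator algebra $B^p_r(\Gamma)$ (the subscript $r$ stands for "reduced") is the closure of $\mathbb{C}\Gamma$ (acting through $\lambda$) in this norm. $C^{\ast}_r(\Gamma)=B^2_r(\Gamma)$ is the reduced group $C^{\ast}$-algebra. A length function on $\Gamma$ is a function $l:\Gamma\to[0,\infty)$ such that $l(\gamma)=0$ iff $\gamma$ is the identity element $e$, $l(\gamma^{-1})=l(\gamma)$ for all $\gamma$, and $l(\gamma_1\gamma_2)\le l(\gamma_1)+l(\gamma_2)$ for all $\gamma_1,\gamma_2$. For $n\ge 0$ let $B_n(e)=\{\gamma\in\Gamma: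 l(\gamma)\le n\}$. $\Gamma$ has property $(RD)$ (that is, property $(RD)_2$) if for some length function $l$ on $\Gamma$ there is a polynomial $\mathcal{P}$ such that for every $n\ge 0$ and every $f\in\mathbb{C}\Gamma$ with support in $B_n(e)$, $\|f\|_{\mathcal{B}(\ell^2(\Gamma))}\le\mathcal{P}(n)\|f\|_{\ell^2(\Gamma)}$. *)

theory Defs
  imports "HOL-Analysis.Analysis" "HOL-Algebra.Ring"
begin

text \<open>
  The space \<open>\<ell>\<^sup>p(X)\<close> depends on the exponent \<open>p \<in> [1,\<infinity>]\<close>, so it is rendered as a set of
  functions rather than as a type.  Functions on \<open>X\<close> are extended by zero outside \<open>X\<close>, which
  makes equality of vectors the same as equality of functions.
\<close>

definition lp_space :: "ennreal \<Rightarrow> 'a set \<Rightarrow> ('a \<Rightarrow> complex) set" where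
  "lp_space p X = {\<xi>. (\<forall>x. x \<notin> X \<longrightarrow> \<xi> x = 0) \<and>
     (if p = \<infinity> then bounded (\<xi> ` X)
      else (\<lambda>x. cmod (\<xi> x) powr enn2real p) summable_on X)}"

definition lp_norm :: "ennreal \<Rightarrow> 'a set \<Rightarrow> ('a \<Rightarrow> complex) \<Rightarrow> real" where
  "lp_norm p X \<xi> =
     (if p = \<infinity> then (SUP x\<in>X. cmod (\<xi> x))
      else (\<Sum>\<^sub>\<infinity>x\<in>X. cmod (\<xi> x) powr enn2real p) powr (1 / enn2real p))"

text \<open>
  Operators on \<open>\<ell>\<^sup>p(X)\<close> are extensional functions (\<open>undefined\<close> outside \<open>\<ell>\<^sup>p(X)\<close>), so that
  two operators are equal iff they agree on \<open>\<ell>\<^sup>p(X)\<close>.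
\<close>

definition bounded_operators ::
    "ennreal \<Rightarrow> 'a set \<Rightarrow> (('a \<Rightarrow> complex) \<Rightarrow> ('a \<Rightarrow> complex)) set" where
  "bounded_operators p X = {T \<in> lp_space p X \<rightarrow>\<^sub>E lp_space p X.
     (\<forall>\<xi>\<in>lp_space p X. \<forall>\<eta>\<in>lp_space p X. T (\<lambda>x. \<xi> x + \<eta> x) = (\<lambda>x. T \<xi> x + T \<eta> x)) \<and>
     (\<forall>c. \<forall>\<xi>\<in>lp_space p X. T (\<lambda>x. c * \<xi> x) = (\<lambda>x. c * T \<xi> x)) \<and>
     (\<exists>C. \<forall>\<xi>\<in>lp_space p X. lp_norm p X (T \<xi>) \<le> C * lp_norm p X \<xi>)}"

definition operator_norm ::
    "ennreal \<Rightarrow> 'a set \<Rightarrow> (('a \<Rightarrow> complex) \<Rightarrow> ('a \<Rightarrow> complex)) \<Rightarrow> real" where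
  "operator_norm p X T = (SUP \<xi>\<in>{\<xi> \<in> lp_space p X. lp_norm p X \<xi> \<le> 1}. lp_norm p X (T \<xi>))"

definition operator_algebra ::
    "ennreal \<Rightarrow> 'a set \<Rightarrow> (('a \<Rightarrow> complex) \<Rightarrow> ('a \<Rightarrow> complex)) ring" where
  "operator_algebra p X =
     \<lparr>carrier = bounded_operators p X,
      mult = compose (lp_space p X),
      one = (\<lambda>\<xi>\<in>lp_space p X. \<xi>),
      zero = (\<lambda>\<xi>\<in>lp_space p X. \<lambda>x. 0),
      add = (\<lambda>S T. \<lambda>\<xi>\<in>lp_space p X. \<lambda>x. S \<xi> x + T \<xi> x)\<rparr>"

definition group_algebra :: "('g, 'm) monoid_scheme \<Rightarrow> ('g \<Rightarrow> complex) set" where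
  "group_algebra \<Gamma> = {f. finite {\<gamma>. f \<gamma> \<noteq> 0} \<and> {\<gamma>. f \<gamma> \<noteq> 0} \<subseteq> carrier \<Gamma>}"

definition left_regular ::
    "ennreal \<Rightarrow> ('g, 'm) monoid_scheme \<Rightarrow> 'g \<Rightarrow> ('g \<Rightarrow> complex) \<Rightarrow> ('g \<Rightarrow> complex)" where
  "left_regular p \<Gamma> \<gamma> = (\<lambda>\<xi>\<in>lp_space p (carrier \<Gamma>).
     \<lambda>\<alpha>. if \<alpha> \<in> carrier \<Gamma> then \<xi> (inv\<^bsub>\<Gamma>\<^esub> \<gamma> \<otimes>\<^bsub>\<Gamma>\<^esub> \<alpha>) else 0)"

text \<open>The linear extension of the left regular representation to the group algebra.\<close>

definition regular_rep ::
    "ennreal \<Rightarrow> ('g, 'm) monoid_scheme \<Rightarrow> ('g \<Rightarrow> complex) \<Rightarrow>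
     ('g \<Rightarrow> complex) \<Rightarrow> ('g \<Rightarrow> complex)" where
  "regular_rep p \<Gamma> f = (\<lambda>\<xi>\<in>lp_space p (carrier \<Gamma>).
     \<lambda>\<alpha>. \<Sum>\<gamma> | f \<gamma> \<noteq> 0. f \<gamma> * left_regular p \<Gamma> \<gamma> \<xi> \<alpha>)"

text \<open>The norm closure of the image of the group algebra in the bounded operators on \<open>\<ell>\<^sup>p\<close>.\<close>

definition reduced_group_lp_algebra ::
    "ennreal \<Rightarrow> ('g, 'm) monoid_scheme \<Rightarrow> (('g \<Rightarrow> complex) \<Rightarrow> ('g \<Rightarrow> complex)) ring" where
  "reduced_group_lp_algebra p \<Gamma> = (operator_algebra p (carrier \<Gamma>))
     \<lparr>carrier := {T \<in> bounded_operators p (carrier \<Gamma>). \<forall>\<epsilon>>0. \<exists>f\<in>group_algebra \<Gamma>.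
        operator_norm p (carrier \<Gamma>)
          (\<lambda>\<xi>\<in>lp_space p (carrier \<Gamma>). \<lambda>\<alpha>. T \<xi> \<alpha> - regular_rep p \<Gamma> f \<xi> \<alpha>) < \<epsilon>}\<rparr>"

definition reduced_group_Cstar_algebra ::
    "('g, 'm) monoid_scheme \<Rightarrow> (('g \<Rightarrow> complex) \<Rightarrow> ('g \<Rightarrow> complex)) ring" where
  "reduced_group_Cstar_algebra \<Gamma> = reduced_group_lp_algebra 2 \<Gamma>"

definition nontrivial_idempotent :: "('a, 'm) ring_scheme \<Rightarrow> 'a \<Rightarrow> bool" where
  "nontrivial_idempotent A a \<longleftrightarrow>
     a \<in> carrier A \<and> a \<otimes>\<^bsub>A\<^esub> a = a \<and> a \<noteq> \<zero>\<^bsub>A\<^esub> \<and> a \<noteq> \<one>\<^bsub>A\<^esub>"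

definition length_function :: "('g, 'm) monoid_scheme \<Rightarrow> ('g \<Rightarrow> real) \<Rightarrow> bool" where
  "length_function \<Gamma> l \<longleftrightarrow>
     (\<forall>\<gamma>\<in>carrier \<Gamma>. 0 \<le> l \<gamma>) \<and>
     (\<forall>\<gamma>\<in>carrier \<Gamma>. l \<gamma> = 0 \<longleftrightarrow> \<gamma> = \<one>\<^bsub>\<Gamma>\<^esub>) \<and>
     (\<forall>\<gamma>\<in>carrier \<Gamma>. l (inv\<^bsub>\<Gamma>\<^esub> \<gamma>) = l \<gamma>) \<and>
     (\<forall>\<gamma>\<^sub>1\<in>carrier \<Gamma>. \<forall>\<gamma>\<^sub>2\<in>carrier \<Gamma>. l (\<gamma>\<^sub>1 \<otimes>\<^bsub>\<Gamma>\<^esub> \<gamma>\<^sub>2) \<le> l \<gamma>\<^sub>1 + l \<gamma>\<^sub>2)"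

definition length_ball :: "('g, 'm) monoid_scheme \<Rightarrow> ('g \<Rightarrow> real) \<Rightarrow> nat \<Rightarrow> 'g set" where
  "length_ball \<Gamma> l n = {\<gamma> \<in> carrier \<Gamma>. l \<gamma> \<le> real n}"

definition property_RD :: "('g, 'm) monoid_scheme \<Rightarrow> bool" where
  "property_RD \<Gamma> \<longleftrightarrow> (\<exists>l. length_function \<Gamma> l \<and>
     (\<exists>P :: real poly. \<forall>n. \<forall>f\<in>group_algebra \<Gamma>. {\<gamma>. f \<gamma> \<noteq> 0} \<subseteq> length_ball \<Gamma> l n \<longrightarrow>
        operator_norm 2 (carrier \<Gamma>) (regular_rep 2 \<Gamma> f)
          \<le> poly P (real n) * lp_norm 2 (carrier \<Gamma>) f))"

end

theory Submission imports Defs begin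

text \<open>
  The algebras for the exponents \<open>p\<close> and \<open>2\<close> are compared through the group algebra. For \<open>f\<close> in
  the group algebra, the \<open>\<ell>\<^sup>2\<close> norm of the coefficients of \<open>f\<close> is bounded by the norm of
  convolution by \<open>f\<close> on \<open>\<ell>\<^sup>p\<close>, whatever \<open>p\<close> is (\<open>lp_bounded_2_self\<close>). Rapid decay therefore
  bounds the operator norm on \<open>\<ell>\<^sup>2\<close> by the operator norm on \<open>\<ell>\<^sup>p\<close>, up to a factor polynomial
  in the radius of the support.

  Let \<open>a\<close> be an idempotent of the algebra for \<open>p\<close>, and let \<open>b\<close> in the group algebra be close to it.
  The iteration \<open>v \<mapsto> 3 v\<^sup>2 - 2 v\<^sup>3\<close> started at \<open>b\<close> squares the defect \<open>v - v\<^sup>2\<close>, up to a constant,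
  in each step, while the degree in \<open>b\<close>, and with it the radius of the support, is only multiplied by
  three (\<open>idempotent_iteration\<close>). On \<open>\<ell>\<^sup>p\<close> the increments decay doubly exponentially, which beats
  the exponential loss incurred in passing to \<open>\<ell>\<^sup>2\<close>. So the iterates converge in the reduced
  \<open>C\<^sup>*\<close>-algebra as well, and the limit there is an idempotent (\<open>Cauchy_idempotent_limit\<close>). By
  assumption this limit is \<open>0\<close> or the unit. In particular the coefficients of the iterates converge
  pointwise to those of \<open>0\<close> or of the unit.

  The norm on \<open>\<ell>\<^sup>p\<close> of elements of the group algebra is lower semicontinuous under pointwise
  convergence of coefficients (\<open>convolution_norm_limit\<close>), and all iterates are within \<open>1 / 8\<close> of
  \<open>b\<close>. Hence \<open>b\<close> is within \<open>1 / 8\<close> of \<open>0\<close> or of the unit, and \<open>a\<close> is at distance less than \<open>1\<close>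
  from it. An idempotent of norm less than \<open>1\<close> is \<open>0\<close>, so \<open>a\<close> or its complement vanishes.
\<close>

section \<open>Norm bounds through finite subsets\<close>

text \<open>
  A norm bound \<open>C\<close> that is tested on finite subsets of \<open>X\<close> only, for \<open>p = \<infinity>\<close> on single points.
  It carries no summability condition and passes to pointwise limits, because finite sums are
  continuous; this is why it replaces \<^const>\<open>lp_space\<close> and \<^const>\<open>lp_norm\<close> in all estimates.
\<close>

definition lp_bounded :: "ennreal \<Rightarrow> 'a set \<Rightarrow> real \<Rightarrow> ('a \<Rightarrow> complex) \<Rightarrow> bool" where
  "lp_bounded p X C \<xi> \<longleftrightarrow> (\<forall>x. x \<notin> X \<longrightarrow> \<xi> x = 0) \<and>
     (if p = \<infinity> then \<forall>x\<in>X. cmod (\<xi> x) \<le> C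
      else \<forall>F. finite F \<longrightarrow> F \<subseteq> X \<longrightarrow>
        (\<Sum>x\<in>F. cmod (\<xi> x) powr enn2real p) \<le> C powr enn2real p)"

lemma one_le_enn2real:
  assumes "1 \<le> p" "p \<noteq> \<infinity>"
  shows "1 \<le> enn2real p"
  using enn2real_mono[of 1 p] assms by (simp add: top.not_eq_extremum)

lemma lp_bounded_iff:
  assumes p: "1 \<le> p" and X: "X \<noteq> {}" and C: "0 \<le> C"
  shows "lp_bounded p X C \<xi> \<longleftrightarrow> \<xi> \<in> lp_space p X \<and> lp_norm p X \<xi> \<le> C"
proof (cases "p = \<infinity>")
  case True
  have "(\<forall>x\<in>X. cmod (\<xi> x) \<le> C) \<longleftrightarrow> bounded (\<xi> ` X) \<and> (SUP x\<in>X. cmod (\<xi> x)) \<le> C"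
  proof (intro iffI conjI ballI)
    assume *: "\<forall>x\<in>X. cmod (\<xi> x) \<le> C"
    then show "bounded (\<xi> ` X)" by (auto simp: bounded_iff)
    from * show "(SUP x\<in>X. cmod (\<xi> x)) \<le> C" using X by (intro cSUP_least) auto
  next
    fix x assume *: "bounded (\<xi> ` X) \<and> (SUP x\<in>X. cmod (\<xi> x)) \<le> C" and x: "x \<in> X"
    have "bdd_above ((\<lambda>x. cmod (\<xi> x)) ` X)"
      using * by (auto simp: bounded_iff bdd_above_def)
    then have "cmod (\<xi> x) \<le> (SUP x\<in>X. cmod (\<xi> x))" using x by (intro cSUP_upper)
    with * show "cmod (\<xi> x) \<le> C" by linarith
  qed
  with True show ?thesis by (auto simp: lp_bounded_def lp_space_def lp_norm_def)
next
  case False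
  define r where "r = enn2real p"
  have r: "1 \<le> r" using one_le_enn2real[OF p False] by (simp add: r_def)
  let ?g = "\<lambda>x. cmod (\<xi> x) powr r"
  have "(\<forall>F. finite F \<longrightarrow> F \<subseteq> X \<longrightarrow> sum ?g F \<le> C powr r) \<longleftrightarrow>
      ?g summable_on X \<and> infsum ?g X powr (1 / r) \<le> C"
  proof (intro iffI conjI allI impI)
    assume *: "\<forall>F. finite F \<longrightarrow> F \<subseteq> X \<longrightarrow> sum ?g F \<le> C powr r"
    show s: "?g summable_on X"
      by (rule nonneg_bdd_above_summable_on) (use * in \<open>auto simp: bdd_above_def\<close>)
    have "infsum ?g X \<le> C powr r"
      by (rule infsum_le_finite_sums[OF s]) (use * in auto)
    then have "infsum ?g X powr (1 / r) \<le> (C powr r) powr (1 / r)"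
      using r by (intro powr_mono2) (auto intro: infsum_nonneg)
    then show "infsum ?g X powr (1 / r) \<le> C" using r C by (simp add: powr_powr)
  next
    fix F assume *: "?g summable_on X \<and> infsum ?g X powr (1 / r) \<le> C" and F: "finite F" "F \<subseteq> X"
    have "sum ?g F \<le> infsum ?g X"
      by (rule finite_sum_le_infsum) (use * F in auto)
    also have "\<dots> = (infsum ?g X powr (1 / r)) powr r"
      using r by (simp add: powr_powr infsum_nonneg)
    also have "\<dots> \<le> C powr r" using * r by (intro powr_mono2) auto
    finally show "sum ?g F \<le> C powr r" .
  qed
  with False show ?thesis by (auto simp: lp_bounded_def lp_space_def lp_norm_def r_def)
qed

lemma lp_norm_nonneg:
  assumes "X \<noteq> {}" "\<xi> \<in> lp_space p X"
  shows "0 \<le> lp_norm p X \<xi>"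
proof (cases "p = \<infinity>")
  case True
  obtain x where x: "x \<in> X" using assms by auto
  have "bdd_above ((\<lambda>x. cmod (\<xi> x)) ` X)"
    using assms True by (auto simp: lp_space_def bounded_iff bdd_above_def)
  then have "cmod (\<xi> x) \<le> (SUP x\<in>X. cmod (\<xi> x))" using x by (intro cSUP_upper)
  then have "0 \<le> (SUP x\<in>X. cmod (\<xi> x))" using norm_ge_zero[of "\<xi> x"] by linarith
  then show ?thesis using True by (simp add: lp_norm_def)
qed (simp add: lp_norm_def)

lemma lp_bounded_norm:
  assumes "1 \<le> p" "X \<noteq> {}" "\<xi> \<in> lp_space p X"
  shows "lp_bounded p X (lp_norm p X \<xi>) \<xi>"
  using assms lp_norm_nonneg[OF assms(2,3)] by (simp add: lp_bounded_iff)

lemma lp_bounded_outside: "lp_bounded p X C \<xi> \<Longrightarrow> x \<notin> X \<Longrightarrow> \<xi> x = 0"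
  by (simp add: lp_bounded_def)

lemma lp_bounded_zero: "0 \<le> C \<Longrightarrow> lp_bounded p X C (\<lambda>x. 0)"
  by (simp add: lp_bounded_def)

lemma lp_bounded_dominated:
  assumes "lp_bounded p X C \<xi>" "\<And>x. cmod (\<eta> x) \<le> cmod (\<xi> x)"
  shows "lp_bounded p X C \<eta>"
proof -
  have z: "\<eta> x = 0" if "\<xi> x = 0" for x using assms(2)[of x] that by simp
  show ?thesis
  proof (cases "p = \<infinity>")
    case True
    with assms z show ?thesis unfolding lp_bounded_def by (auto intro: order_trans[OF assms(2)])
  next
    case False
    have "(\<Sum>x\<in>F. cmod (\<eta> x) powr enn2real p) \<le> (\<Sum>x\<in>F. cmod (\<xi> x) powr enn2real p)" for F
      by (intro sum_mono powr_mono2) (auto simp: assms)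
    with False assms(1) z show ?thesis unfolding lp_bounded_def by (fastforce intro: order_trans)
  qed
qed

lemma lp_bounded_mono:
  assumes "lp_bounded p X C \<xi>" "0 \<le> C" "C \<le> D"
  shows "lp_bounded p X D \<xi>"
proof (cases "p = \<infinity>")
  case True
  with assms show ?thesis unfolding lp_bounded_def by (auto intro: order_trans)
next
  case False
  have "C powr enn2real p \<le> D powr enn2real p" using assms by (intro powr_mono2) auto
  with False assms(1) show ?thesis unfolding lp_bounded_def by (auto intro: order_trans)
qed

lemma lp_bounded_scale:
  assumes "lp_bounded p X C \<xi>" "0 \<le> C"
  shows "lp_bounded p X (cmod c * C) (\<lambda>x. c * \<xi> x)"
proof (cases "p = \<infinity>")
  case True
  with assms show ?thesis unfolding lp_bounded_def by (auto simp: norm_mult mult_left_mono)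
next
  case False
  have "(\<Sum>x\<in>F. cmod (c * \<xi> x) powr enn2real p) \<le> (cmod c * C) powr enn2real p"
    if "finite F" "F \<subseteq> X" for F
  proof -
    have "(\<Sum>x\<in>F. cmod (c * \<xi> x) powr enn2real p)
        = cmod c powr enn2real p * (\<Sum>x\<in>F. cmod (\<xi> x) powr enn2real p)"
      by (simp add: norm_mult powr_mult sum_distrib_left)
    also have "\<dots> \<le> cmod c powr enn2real p * C powr enn2real p"
      using assms that False by (intro mult_left_mono) (auto simp: lp_bounded_def)
    finally show ?thesis using assms by (simp add: powr_mult)
  qed
  with False assms show ?thesis unfolding lp_bounded_def by auto
qed

lemma lp_bounded_coordinate:
  assumes "1 \<le> p" "0 \<le> C" "lp_bounded p X C \<xi>"
  shows "cmod (\<xi> x) \<le> C"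
proof (cases "x \<in> X")
  case x: True
  show ?thesis
  proof (cases "p = \<infinity>")
    case False
    have "(\<Sum>y\<in>{x}. cmod (\<xi> y) powr enn2real p) \<le> C powr enn2real p"
      using assms False x unfolding lp_bounded_def by (metis (no_types) empty_subsetI finite.emptyI finite.insertI insert_subset)
    then show ?thesis
      using one_le_enn2real[OF assms(1) False] assms(2) powr_less_mono2[of "enn2real p" C "cmod (\<xi> x)"]
      by (simp) (meson less_le_not_le not_le less_le_trans zero_less_one)
  qed (use assms x in \<open>auto simp: lp_bounded_def\<close>)
qed (use assms in \<open>auto simp: lp_bounded_def\<close>)

text \<open>
  Convexity of the power function on the closed half line. When one of the two points is \<open>0\<close>, it
  reduces to \<open>s powr r \<le> s\<close> for \<open>s\<close> in the unit interval.
\<close>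

lemma powr_weighted_mean:
  fixes x y t r :: real
  assumes "1 \<le> r" "0 \<le> x" "0 \<le> y" "0 \<le> t" "t \<le> 1"
  shows "((1 - t) * x + t * y) powr r \<le> (1 - t) * x powr r + t * y powr r"
proof -
  have small: "(s * z) powr r \<le> s * z powr r" if "0 \<le> s" "s \<le> 1" "0 \<le> z" for s z :: real
  proof -
    have "s powr r \<le> s" using that assms powr_mono'[of 1 r s] by (cases "s = 0") auto
    then show ?thesis using that by (simp add: powr_mult mult_right_mono)
  qed
  consider "x = 0" | "y = 0" | "0 < x" "0 < y" using assms by force
  then show ?thesis
  proof cases
    case 3
    then show ?thesis
      using convex_onD[OF powr_convex[OF assms(1)], of t x y] assms by auto
  qed (use small[of t y] small[of "1 - t" x] assms in auto)
qed

text \<open>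
  Minkowski's inequality. The vector \<open>(\<xi> + \<eta>) / (C + D)\<close> is a convex combination of \<open>\<xi> / C\<close> and
  \<open>\<eta> / D\<close>, and the unit ball is convex because the power function is.
\<close>

lemma lp_bounded_add:
  assumes p: "1 \<le> p" and CD: "0 \<le> C" "0 \<le> D"
    and \<xi>: "lp_bounded p X C \<xi>" and \<eta>: "lp_bounded p X D \<eta>"
  shows "lp_bounded p X (C + D) (\<lambda>x. \<xi> x + \<eta> x)"
proof (cases "p = \<infinity>")
  case True
  have "cmod (\<xi> x + \<eta> x) \<le> C + D" for x
    using lp_bounded_coordinate[OF p CD(1) \<xi>, of x] lp_bounded_coordinate[OF p CD(2) \<eta>, of x]
      norm_triangle_ineq[of "\<xi> x" "\<eta> x"] by linarith
  with True \<xi> \<eta> show ?thesis by (simp add: lp_bounded_def)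
next
  case False
  define r where "r = enn2real p"
  have r: "1 \<le> r" using one_le_enn2real[OF p False] by (simp add: r_def)
  consider "C = 0" | "D = 0" | "0 < C" "0 < D" using CD by force
  then show ?thesis
  proof cases
    case 1
    then have "\<xi> x = 0" for x using lp_bounded_coordinate[OF p _ \<xi>, of x] by simp
    with 1 \<eta> show ?thesis by simp
  next
    case 2
    then have "\<eta> x = 0" for x using lp_bounded_coordinate[OF p _ \<eta>, of x] by simp
    with 2 \<xi> show ?thesis by simp
  next
    case 3
    \<comment> \<open>the weight of \<open>\<eta> / D\<close> in the convex combination\<close>
    define t where "t = D / (C + D)"
    have t: "0 \<le> t" "t \<le> 1" using 3 by (auto simp: t_def)
    have tC: "(1 - t) * (C + D) = C" and tD: "t * (C + D) = D"
      using 3 by (auto simp: t_def field_simps)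
    have pt: "cmod (\<xi> x + \<eta> x) powr r \<le> (C + D) powr r *
        ((1 - t) * (cmod (\<xi> x) powr r / C powr r) + t * (cmod (\<eta> x) powr r / D powr r))" for x
    proof -
      have "cmod (\<xi> x + \<eta> x) \<le> cmod (\<xi> x) + cmod (\<eta> x)" by (rule norm_triangle_ineq)
      also have "\<dots> = ((1 - t) * (C + D)) * (cmod (\<xi> x) / C) + (t * (C + D)) * (cmod (\<eta> x) / D)"
        unfolding tC tD using 3 by simp
      also have "\<dots> = (C + D) * ((1 - t) * (cmod (\<xi> x) / C) + t * (cmod (\<eta> x) / D))"
        by (simp only: distrib_left[of "C + D"] mult.assoc mult.left_commute[of "C + D"])
      finally have "cmod (\<xi> x + \<eta> x) powr r
          \<le> ((C + D) * ((1 - t) * (cmod (\<xi> x) / C) + t * (cmod (\<eta> x) / D))) powr r"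
        using r by (intro powr_mono2) auto
      also have "\<dots> = (C + D) powr r * ((1 - t) * (cmod (\<xi> x) / C) + t * (cmod (\<eta> x) / D)) powr r"
        using t 3 by (subst powr_mult) auto
      also have "\<dots> \<le> (C + D) powr r *
          ((1 - t) * (cmod (\<xi> x) / C) powr r + t * (cmod (\<eta> x) / D) powr r)"
        using t 3 r by (intro mult_left_mono powr_weighted_mean) auto
      finally show ?thesis using 3 by (simp add: powr_divide)
    qed
    have "(\<Sum>x\<in>F. cmod (\<xi> x + \<eta> x) powr r) \<le> (C + D) powr r" if F: "finite F" "F \<subseteq> X" for F
    proof -
      have a: "(\<Sum>x\<in>F. cmod (\<xi> x) powr r) / C powr r \<le> 1"
        using \<xi> F False 3 by (auto simp: lp_bounded_def r_def divide_le_eq)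
      have b: "(\<Sum>x\<in>F. cmod (\<eta> x) powr r) / D powr r \<le> 1"
        using \<eta> F False 3 by (auto simp: lp_bounded_def r_def divide_le_eq)
      have "(\<Sum>x\<in>F. cmod (\<xi> x + \<eta> x) powr r) \<le> (\<Sum>x\<in>F. (C + D) powr r *
        ((1 - t) * (cmod (\<xi> x) powr r / C powr r) + t * (cmod (\<eta> x) powr r / D powr r)))"
        by (rule sum_mono) (rule pt)
      also have "\<dots> = (C + D) powr r * ((1 - t) * ((\<Sum>x\<in>F. cmod (\<xi> x) powr r) / C powr r)
          + t * ((\<Sum>x\<in>F. cmod (\<eta> x) powr r) / D powr r))"
        by (simp only: sum_distrib_left[symmetric] sum.distrib sum_divide_distrib[symmetric])
      also have "\<dots> \<le> (C + D) powr r * ((1 - t) * 1 + t * 1)"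
        using t a b by (intro mult_left_mono add_mono) auto
      finally show ?thesis by simp
    qed
    with False \<xi> \<eta> show ?thesis by (simp add: lp_bounded_def r_def)
  qed
qed

lemma lp_bounded_sum:
  assumes "1 \<le> p" "finite I" "\<And>i. i \<in> I \<Longrightarrow> 0 \<le> C i" "\<And>i. i \<in> I \<Longrightarrow> lp_bounded p X (C i) (\<xi> i)"
  shows "lp_bounded p X (\<Sum>i\<in>I. C i) (\<lambda>x. \<Sum>i\<in>I. \<xi> i x)"
  using assms(2-) by (induction I rule: finite_induct) (auto simp: lp_bounded_zero intro!: lp_bounded_add assms(1) sum_nonneg)

lemma lp_bounded_bij:
  assumes \<xi>: "lp_bounded p X C \<xi>" and \<phi>: "bij_betw \<phi> X X"
    and \<eta>: "\<And>x. x \<in> X \<Longrightarrow> cmod (\<eta> x) = cmod (\<xi> (\<phi> x))" "\<And>x. x \<notin> X \<Longrightarrow> \<eta> x = 0"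
  shows "lp_bounded p X C \<eta>"
proof (cases "p = \<infinity>")
  case True
  have "\<phi> x \<in> X" if "x \<in> X" for x using \<phi> that by (auto simp: bij_betw_def)
  with True assms show ?thesis by (simp add: lp_bounded_def)
next
  case False
  have "(\<Sum>x\<in>F. cmod (\<eta> x) powr enn2real p) \<le> C powr enn2real p" if F: "finite F" "F \<subseteq> X" for F
  proof -
    have "inj_on \<phi> F" using \<phi> F by (meson bij_betw_def inj_on_subset)
    then have "(\<Sum>x\<in>\<phi> ` F. cmod (\<xi> x) powr enn2real p) = (\<Sum>x\<in>F. cmod (\<eta> x) powr enn2real p)"
      using F by (subst sum.reindex) (auto intro!: sum.cong simp: \<eta> subset_iff)
    moreover have "\<phi> ` F \<subseteq> X" using \<phi> F by (auto simp: bij_betw_def)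
    ultimately show ?thesis using \<xi> F False unfolding lp_bounded_def by (metis finite_imageI)
  qed
  with False \<eta> show ?thesis by (simp add: lp_bounded_def)
qed

text \<open>
  All coordinates are at most \<open>C\<close>, so raising the exponent from \<open>r\<close> to \<open>s\<close> costs a factor of at most
  \<open>C powr (s - r)\<close> in every term of the sum.
\<close>

lemma lp_bounded_exponent_mono:
  assumes p: "1 \<le> p" "p \<le> q" and C: "0 \<le> C" and \<xi>: "lp_bounded p X C \<xi>"
  shows "lp_bounded q X C \<xi>"
proof -
  have c: "cmod (\<xi> x) \<le> C" for x by (rule lp_bounded_coordinate[OF p(1) C \<xi>])
  show ?thesis
  proof (cases "q = \<infinity>")
    case True
    with c \<xi> show ?thesis by (simp add: lp_bounded_def)
  next
    case q: False
    then have pf: "p \<noteq> \<infinity>" using p by (auto simp: top_unique)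
    define r s where "r = enn2real p" and "s = enn2real q"
    have rs: "1 \<le> r" "r \<le> s"
      using one_le_enn2real[OF p(1) pf] enn2real_mono[OF p(2)] q by (auto simp: r_def s_def top.not_eq_extremum)
    have pt: "cmod (\<xi> x) powr s \<le> C powr (s - r) * cmod (\<xi> x) powr r" for x
    proof -
      have "cmod (\<xi> x) powr s = cmod (\<xi> x) powr (s - r) * cmod (\<xi> x) powr r"
        by (simp flip: powr_add)
      also have "\<dots> \<le> C powr (s - r) * cmod (\<xi> x) powr r"
        using rs c by (intro mult_right_mono powr_mono2) auto
      finally show ?thesis .
    qed
    have "(\<Sum>x\<in>F. cmod (\<xi> x) powr s) \<le> C powr s" if F: "finite F" "F \<subseteq> X" for F
    proof -
      have "(\<Sum>x\<in>F. cmod (\<xi> x) powr s) \<le> C powr (s - r) * (\<Sum>x\<in>F. cmod (\<xi> x) powr r)"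
        unfolding sum_distrib_left by (rule sum_mono) (rule pt)
      also have "\<dots> \<le> C powr (s - r) * C powr r"
        using \<xi> F pf by (intro mult_left_mono) (auto simp: lp_bounded_def r_def)
      finally show ?thesis by (simp flip: powr_add)
    qed
    with q \<xi> show ?thesis by (simp add: lp_bounded_def s_def)
  qed
qed

text \<open>
  Lower semicontinuity of the norm under pointwise convergence; it stands in for Fatou's lemma and
  for the completeness of the sequence spaces.
\<close>

lemma lp_bounded_limit:
  assumes C: "0 \<le> C" and p: "1 \<le> p"
    and lim: "\<And>x. x \<in> X \<Longrightarrow> (\<lambda>n. \<xi> n x) \<longlonglongrightarrow> \<eta> x" and z: "\<And>x. x \<notin> X \<Longrightarrow> \<eta> x = 0"
    and \<xi>: "\<forall>\<^sub>F n in sequentially. lp_bounded p X C (\<xi> n)"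
  shows "lp_bounded p X C \<eta>"
proof (cases "p = \<infinity>")
  case True
  have "cmod (\<eta> x) \<le> C" if x: "x \<in> X" for x
  proof (rule tendsto_upperbound[OF tendsto_norm[OF lim[OF x]]])
    show "\<forall>\<^sub>F n in sequentially. cmod (\<xi> n x) \<le> C"
      using \<xi> by eventually_elim (rule lp_bounded_coordinate[OF p C])
  qed simp
  with True z show ?thesis by (simp add: lp_bounded_def)
next
  case False
  define r where "r = enn2real p"
  have r: "1 \<le> r" using one_le_enn2real[OF p False] by (simp add: r_def)
  have "(\<Sum>x\<in>F. cmod (\<eta> x) powr r) \<le> C powr r" if F: "finite F" "F \<subseteq> X" for F
  proof (rule tendsto_upperbound)
    show "(\<lambda>n. \<Sum>x\<in>F. cmod (\<xi> n x) powr r) \<longlonglongrightarrow> (\<Sum>x\<in>F. cmod (\<eta> x) powr r)"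
      using F r by (intro tendsto_sum tendsto_powr2 tendsto_norm lim tendsto_const) auto
    show "\<forall>\<^sub>F n in sequentially. (\<Sum>x\<in>F. cmod (\<xi> n x) powr r) \<le> C powr r"
      using \<xi> by eventually_elim (use F False in \<open>auto simp: lp_bounded_def r_def\<close>)
  qed simp
  with False z show ?thesis by (simp add: lp_bounded_def r_def)
qed

text \<open>
  A bound may be verified on each finite set with a different vector. This replaces density of the
  finitely supported vectors, which fails for \<open>p = \<infinity>\<close>.
\<close>

lemma lp_bounded_local:
  assumes z: "\<And>x. x \<notin> X \<Longrightarrow> \<eta> x = 0"
    and loc: "\<And>F. finite F \<Longrightarrow> F \<subseteq> X \<Longrightarrow> \<exists>\<xi>. lp_bounded p X C \<xi> \<and> (\<forall>x\<in>F. \<xi> x = \<eta> x)"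
  shows "lp_bounded p X C \<eta>"
proof (cases "p = \<infinity>")
  case True
  have "cmod (\<eta> x) \<le> C" if x: "x \<in> X" for x
    using loc[of "{x}"] x True by (auto simp: lp_bounded_def)
  with True z show ?thesis by (simp add: lp_bounded_def)
next
  case False
  have "(\<Sum>x\<in>F. cmod (\<eta> x) powr enn2real p) \<le> C powr enn2real p" if F: "finite F" "F \<subseteq> X" for F
  proof -
    obtain \<xi> where \<xi>: "lp_bounded p X C \<xi>" "\<forall>x\<in>F. \<xi> x = \<eta> x" using loc[OF F] by blast
    then have *: "(\<Sum>x\<in>F. cmod (\<eta> x) powr enn2real p) = (\<Sum>x\<in>F. cmod (\<xi> x) powr enn2real p)"
      by (intro sum.cong) auto
    show ?thesis unfolding * using \<xi>(1) F False by (simp add: lp_bounded_def)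
  qed
  with False z show ?thesis by (simp add: lp_bounded_def)
qed

section \<open>Bounded operators on the sequence spaces\<close>

lemma lp_space_zero: "X \<noteq> {} \<Longrightarrow> 1 \<le> p \<Longrightarrow> (\<lambda>x. 0) \<in> lp_space p X"
  and lp_norm_zero: "X \<noteq> {} \<Longrightarrow> 1 \<le> p \<Longrightarrow> lp_norm p X (\<lambda>x. 0) = 0"
  using lp_bounded_iff[of p X 0 "\<lambda>x. 0"] lp_bounded_zero[of 0 p X] lp_norm_nonneg[of X "\<lambda>x. 0" p]
  by auto

lemma lp_space_add: "X \<noteq> {} \<Longrightarrow> 1 \<le> p \<Longrightarrow> \<xi> \<in> lp_space p X \<Longrightarrow> \<eta> \<in> lp_space p X \<Longrightarrow>
    (\<lambda>x. \<xi> x + \<eta> x) \<in> lp_space p X"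
  using lp_bounded_add[of p "lp_norm p X \<xi>" "lp_norm p X \<eta>" X \<xi> \<eta>]
  by (simp add: lp_bounded_norm lp_norm_nonneg lp_bounded_iff)

lemma lp_space_scale: "X \<noteq> {} \<Longrightarrow> 1 \<le> p \<Longrightarrow> \<xi> \<in> lp_space p X \<Longrightarrow> (\<lambda>x. c * \<xi> x) \<in> lp_space p X"
  using lp_bounded_scale[of p X "lp_norm p X \<xi>" \<xi> c]
  by (simp add: lp_bounded_norm lp_norm_nonneg lp_bounded_iff)

lemma lp_space_diff: "X \<noteq> {} \<Longrightarrow> 1 \<le> p \<Longrightarrow> \<xi> \<in> lp_space p X \<Longrightarrow> \<eta> \<in> lp_space p X \<Longrightarrow>
    (\<lambda>x. \<xi> x - \<eta> x) \<in> lp_space p X"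
  using lp_space_add[of X p \<xi> "\<lambda>x. (-1) * \<eta> x"] lp_space_scale[of X p \<eta> "-1"] by simp

lemma lp_bounded_diff:
  "\<lbrakk>1 \<le> p; 0 \<le> C; 0 \<le> D; lp_bounded p X C \<xi>; lp_bounded p X D \<eta>\<rbrakk> \<Longrightarrow> lp_bounded p X (C + D) (\<lambda>x. \<xi> x - \<eta> x)"
  using lp_bounded_add[of p C D X \<xi> "\<lambda>x. (-1) * \<eta> x"] lp_bounded_scale[of p X D \<eta> "-1"] by simp

lemma bounded_operatorsI:
  assumes "1 \<le> p" "X \<noteq> {}" "0 \<le> K"
    and "\<And>\<xi>. \<xi> \<in> lp_space p X \<Longrightarrow> lp_bounded p X (K * lp_norm p X \<xi>) (T \<xi>)"
    and "\<And>\<xi> \<eta>. \<lbrakk>\<xi> \<in> lp_space p X; \<eta> \<in> lp_space p X\<rbrakk> \<Longrightarrow> T (\<lambda>x. \<xi> x + \<eta> x) = (\<lambda>x. T \<xi> x + T \<eta> x)"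
    and "\<And>c \<xi>. \<xi> \<in> lp_space p X \<Longrightarrow> T (\<lambda>x. c * \<xi> x) = (\<lambda>x. c * T \<xi> x)"
  shows "restrict T (lp_space p X) \<in> bounded_operators p X"
proof -
  have *: "T \<xi> \<in> lp_space p X \<and> lp_norm p X (T \<xi>) \<le> K * lp_norm p X \<xi>" if "\<xi> \<in> lp_space p X" for \<xi>
    using assms(4)[OF that] lp_norm_nonneg[OF assms(2) that] assms(1-3)
    by (simp add: lp_bounded_iff)
  then have "\<exists>C. \<forall>\<xi>\<in>lp_space p X. lp_norm p X (T \<xi>) \<le> C * lp_norm p X \<xi>" by blast
  then show ?thesis
    unfolding bounded_operators_def using * assms
    by (auto simp: lp_space_add lp_space_scale)
qed

lemma bounded_operators_add:
  assumes "T \<in> bounded_operators p X" "\<xi> \<in> lp_space p X" "\<eta> \<in> lp_space p X"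
  shows "T (\<lambda>x. \<xi> x + \<eta> x) = (\<lambda>x. T \<xi> x + T \<eta> x)"
  using assms by (simp add: bounded_operators_def)

lemma bounded_operators_scale:
  assumes "T \<in> bounded_operators p X" "\<xi> \<in> lp_space p X"
  shows "T (\<lambda>x. c * \<xi> x) = (\<lambda>x. c * T \<xi> x)"
  using assms by (simp add: bounded_operators_def)

lemma bounded_operators_memD:
  assumes "T \<in> bounded_operators p X" "\<xi> \<in> lp_space p X"
  shows "T \<xi> \<in> lp_space p X"
  using assms by (auto simp: bounded_operators_def)

lemma bounded_operators_diff:
  assumes "X \<noteq> {}" "1 \<le> p" "T \<in> bounded_operators p X" "\<xi> \<in> lp_space p X" "\<eta> \<in> lp_space p X"
  shows "T (\<lambda>x. \<xi> x - \<eta> x) = (\<lambda>x. T \<xi> x - T \<eta> x)"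
proof -
  have "T (\<lambda>x. \<xi> x + (-1) * \<eta> x) = (\<lambda>x. T \<xi> x + T (\<lambda>x. (-1) * \<eta> x) x)"
    by (rule bounded_operators_add[OF assms(3,4) lp_space_scale[OF assms(1,2,5), of "-1"]])
  moreover have "T (\<lambda>x. (-1) * \<eta> x) = (\<lambda>x. (-1) * T \<eta> x)"
    by (rule bounded_operators_scale[OF assms(3,5)])
  ultimately show ?thesis by simp
qed

lemma bdd_above_operator_norm:
  assumes T: "T \<in> bounded_operators p X" and X: "X \<noteq> {}"
  shows "bdd_above ((\<lambda>\<xi>. lp_norm p X (T \<xi>)) ` {\<xi> \<in> lp_space p X. lp_norm p X \<xi> \<le> 1})"
proof -
  obtain C where C: "\<And>\<xi>. \<xi> \<in> lp_space p X \<Longrightarrow> lp_norm p X (T \<xi>) \<le> C * lp_norm p X \<xi>"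
    using T unfolding bounded_operators_def by blast
  have "lp_norm p X (T \<xi>) \<le> \<bar>C\<bar>" if "\<xi> \<in> lp_space p X" "lp_norm p X \<xi> \<le> 1" for \<xi>
  proof -
    have "lp_norm p X (T \<xi>) \<le> C * lp_norm p X \<xi>" using C that by blast
    also have "\<dots> \<le> \<bar>C\<bar> * 1" using that lp_norm_nonneg[OF X that(1)] by (intro mult_mono) auto
    finally show ?thesis by simp
  qed
  then show ?thesis by (auto simp: bdd_above_def)
qed

lemma operator_norm_nonneg:
  assumes T: "T \<in> bounded_operators p X" and X: "X \<noteq> {}" and p: "1 \<le> p"
  shows "0 \<le> operator_norm p X T"
proof -
  have z: "(\<lambda>x. 0) \<in> {\<xi> \<in> lp_space p X. lp_norm p X \<xi> \<le> 1}"
    using lp_space_zero[OF X p] lp_norm_zero[OF X p] by simp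
  then have "0 \<le> lp_norm p X (T (\<lambda>x. 0))"
    using bounded_operators_memD[OF T] by (intro lp_norm_nonneg[OF X]) auto
  also have "\<dots> \<le> operator_norm p X T"
    unfolding operator_norm_def by (rule cSUP_upper[OF z bdd_above_operator_norm[OF T X]])
  finally show ?thesis .
qed

text \<open>
  The operator norm is a supremum over the unit ball; homogeneity extends the bound to all vectors.
  The case \<open>C = 0\<close> is separate since the vector cannot be rescaled then.
\<close>

lemma lp_bounded_operator_norm:
  assumes T: "T \<in> bounded_operators p X" and X: "X \<noteq> {}" and p: "1 \<le> p"
    and C: "0 \<le> C" and \<xi>: "lp_bounded p X C \<xi>"
  shows "lp_bounded p X (operator_norm p X T * C) (T \<xi>)"
proof (cases "C = 0")
  case True
  then have "\<xi> = (\<lambda>x. 0)" using lp_bounded_coordinate[OF p C \<xi>] by auto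
  moreover have "T (\<lambda>x. 0 * 0) = (\<lambda>x. 0 * T (\<lambda>x. 0) x)"
    by (rule bounded_operators_scale[OF T lp_space_zero[OF X p]])
  ultimately show ?thesis using True by (simp add: lp_bounded_zero)
next
  case False
  with C have C: "0 < C" by simp
  have lp: "\<xi> \<in> lp_space p X" using \<xi> C p X by (simp add: lp_bounded_iff)
  define \<eta> where "\<eta> = (\<lambda>x. complex_of_real (1 / C) * \<xi> x)"
  have "lp_bounded p X (cmod (complex_of_real (1 / C)) * C) \<eta>"
    unfolding \<eta>_def using \<xi> C by (intro lp_bounded_scale) auto
  then have "lp_bounded p X 1 \<eta>" using C by (simp add: norm_divide)
  then have \<eta>: "\<eta> \<in> {\<xi> \<in> lp_space p X. lp_norm p X \<xi> \<le> 1}" using p X by (simp add: lp_bounded_iff)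
  have "lp_norm p X (T \<eta>) \<le> operator_norm p X T"
    unfolding operator_norm_def by (rule cSUP_upper[OF \<eta> bdd_above_operator_norm[OF T X]])
  then have "lp_bounded p X (operator_norm p X T) (T \<eta>)"
    using \<eta> bounded_operators_memD[OF T] p X operator_norm_nonneg[OF T X p] by (simp add: lp_bounded_iff)
  from lp_bounded_scale[OF this operator_norm_nonneg[OF T X p], of "complex_of_real C"]
  have "lp_bounded p X (operator_norm p X T * C) (\<lambda>x. complex_of_real C * T \<eta> x)"
    using C by (simp add: mult.commute)
  moreover have "T \<eta> = (\<lambda>x. complex_of_real (1 / C) * T \<xi> x)"
    unfolding \<eta>_def by (rule bounded_operators_scale[OF T lp])
  ultimately show ?thesis using C by simp
qed

lemma operator_norm_le:
  assumes X: "X \<noteq> {}" and p: "1 \<le> p" and K: "0 \<le> K"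
    and T: "\<And>\<xi>. \<xi> \<in> lp_space p X \<Longrightarrow> lp_bounded p X (K * lp_norm p X \<xi>) (T \<xi>)"
  shows "operator_norm p X T \<le> K"
  unfolding operator_norm_def
proof (rule cSUP_least)
  show "{\<xi> \<in> lp_space p X. lp_norm p X \<xi> \<le> 1} \<noteq> {}"
    using lp_space_zero[OF X p] lp_norm_zero[OF X p] by (metis (mono_tags, lifting) empty_iff mem_Collect_eq zero_le_one)
  fix \<xi> assume \<xi>: "\<xi> \<in> {\<xi> \<in> lp_space p X. lp_norm p X \<xi> \<le> 1}"
  then have n: "0 \<le> lp_norm p X \<xi>" using lp_norm_nonneg[OF X] by blast
  then have "lp_norm p X (T \<xi>) \<le> K * lp_norm p X \<xi>"
    using T[of \<xi>] \<xi> X p K by (simp add: lp_bounded_iff)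
  also have "\<dots> \<le> K * 1" using \<xi> K by (intro mult_left_mono) auto
  finally show "lp_norm p X (T \<xi>) \<le> K" by simp
qed

text \<open>
  Applied to \<open>\<xi> = a \<eta>\<close> for an idempotent operator \<open>a\<close> of norm below \<open>1\<close>: every vector in its range
  is fixed and therefore vanishes. So an idempotent at distance less than \<open>1\<close> from \<open>0\<close> is \<open>0\<close>.
\<close>

lemma contraction_fixed_vector_zero:
  assumes "1 \<le> p" "X \<noteq> {}" "\<xi> \<in> lp_space p X" "\<theta> < 1" "lp_bounded p X (\<theta> * lp_norm p X \<xi>) \<xi>" "0 \<le> \<theta>"
  shows "\<xi> = (\<lambda>x. 0)"
proof -
  have n: "0 \<le> lp_norm p X \<xi>" by (rule lp_norm_nonneg[OF assms(2,3)])
  then have "lp_norm p X \<xi> \<le> \<theta> * lp_norm p X \<xi>" using assms by (simp add: lp_bounded_iff)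
  then have "(1 - \<theta>) * lp_norm p X \<xi> \<le> 0" by (simp add: algebra_simps)
  then have "lp_norm p X \<xi> = 0" using assms(4) n by (simp add: mult_le_0_iff)
  then have "lp_bounded p X 0 \<xi>" using assms by (simp add: lp_bounded_iff)
  then show ?thesis using lp_bounded_coordinate[OF assms(1) order_refl] by fastforce
qed

section \<open>Convolution with finitely supported functions\<close>

text \<open>
  Only the first factor is meant to have finite support, and the second one is an arbitrary function.
  The algebra of convolution operators can then be done once, independently of the exponent.
\<close>

definition convolution :: "('g, 'm) monoid_scheme \<Rightarrow> ('g \<Rightarrow> complex) \<Rightarrow> ('g \<Rightarrow> complex) \<Rightarrow> 'g \<Rightarrow> complex" where
  "convolution G f \<xi> = (\<lambda>\<alpha>. if \<alpha> \<in> carrier G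
     then \<Sum>\<gamma> | f \<gamma> \<noteq> 0. f \<gamma> * \<xi> (inv\<^bsub>G\<^esub> \<gamma> \<otimes>\<^bsub>G\<^esub> \<alpha>) else 0)"

definition unit_mass :: "('g, 'm) monoid_scheme \<Rightarrow> 'g \<Rightarrow> complex" where
  "unit_mass G = (\<lambda>\<gamma>. if \<gamma> = \<one>\<^bsub>G\<^esub> then 1 else 0)"

lemma group_algebraI:
  assumes "finite S" "S \<subseteq> carrier G" "\<And>\<gamma>. \<gamma> \<notin> S \<Longrightarrow> f \<gamma> = 0"
  shows "f \<in> group_algebra G"
proof -
  have "{\<gamma>. f \<gamma> \<noteq> 0} \<subseteq> S" using assms(3) by blast
  then show ?thesis using assms(1,2) finite_subset unfolding group_algebra_def by blast
qed

lemma group_algebra_finite: "f \<in> group_algebra G \<Longrightarrow> finite {\<gamma>. f \<gamma> \<noteq> 0}"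
  and group_algebra_carrier: "f \<in> group_algebra G \<Longrightarrow> {\<gamma>. f \<gamma> \<noteq> 0} \<subseteq> carrier G"
  and group_algebra_outside: "f \<in> group_algebra G \<Longrightarrow> \<gamma> \<notin> carrier G \<Longrightarrow> f \<gamma> = 0"
  by (auto simp: group_algebra_def)

lemma group_algebra_zero: "(\<lambda>\<gamma>. 0) \<in> group_algebra G"
  by (simp add: group_algebra_def)

lemma group_algebra_scale:
  assumes "f \<in> group_algebra G" shows "(\<lambda>\<gamma>. c * f \<gamma>) \<in> group_algebra G"
  by (rule group_algebraI[OF group_algebra_finite[OF assms] group_algebra_carrier[OF assms]]) auto

lemma group_algebra_add:
  assumes "f \<in> group_algebra G" "g \<in> group_algebra G"
  shows "(\<lambda>\<gamma>. f \<gamma> + g \<gamma>) \<in> group_algebra G"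
  by (rule group_algebraI[of "{\<gamma>. f \<gamma> \<noteq> 0} \<union> {\<gamma>. g \<gamma> \<noteq> 0}"]) (use assms in \<open>auto simp: group_algebra_def\<close>)

lemma group_algebra_diff:
  assumes "f \<in> group_algebra G" "g \<in> group_algebra G"
  shows "(\<lambda>\<gamma>. f \<gamma> - g \<gamma>) \<in> group_algebra G"
  by (rule group_algebraI[of "{\<gamma>. f \<gamma> \<noteq> 0} \<union> {\<gamma>. g \<gamma> \<noteq> 0}"]) (use assms in \<open>auto simp: group_algebra_def\<close>)

context group
begin

lemma unit_mass_group_algebra: "unit_mass G \<in> group_algebra G"
  by (rule group_algebraI[of "{\<one>}"]) (auto simp: unit_mass_def)

lemma convolution_superset:
  assumes "finite S" "{\<gamma>. f \<gamma> \<noteq> 0} \<subseteq> S" "\<alpha> \<in> carrier G"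
  shows "convolution G f \<xi> \<alpha> = (\<Sum>\<gamma>\<in>S. f \<gamma> * \<xi> (inv \<gamma> \<otimes> \<alpha>))"
  unfolding convolution_def using assms by (auto intro: sum.mono_neutral_left)

lemma regular_rep_eq:
  assumes "\<xi> \<in> lp_space p (carrier G)"
  shows "regular_rep p G f \<xi> = convolution G f \<xi>"
  using assms by (auto simp: regular_rep_def left_regular_def convolution_def)

lemma convolution_outside: "\<alpha> \<notin> carrier G \<Longrightarrow> convolution G f \<xi> \<alpha> = 0"
  by (simp add: convolution_def)

lemma convolution_add_left:
  assumes "f \<in> group_algebra G" "g \<in> group_algebra G"
  shows "convolution G (\<lambda>\<gamma>. f \<gamma> + g \<gamma>) \<xi> = (\<lambda>\<alpha>. convolution G f \<xi> \<alpha> + convolution G g \<xi> \<alpha>)"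
proof
  fix \<alpha>
  let ?S = "{\<gamma>. f \<gamma> \<noteq> 0} \<union> {\<gamma>. g \<gamma> \<noteq> 0}"
  have S: "finite ?S" using assms by (simp add: group_algebra_def)
  show "convolution G (\<lambda>\<gamma>. f \<gamma> + g \<gamma>) \<xi> \<alpha> = convolution G f \<xi> \<alpha> + convolution G g \<xi> \<alpha>"
  proof (cases "\<alpha> \<in> carrier G")
    case True
    have "{\<gamma>. f \<gamma> + g \<gamma> \<noteq> 0} \<subseteq> ?S" by auto
    with True S show ?thesis
      by (simp add: convolution_superset[of ?S] sum.distrib distrib_right)
  qed (simp add: convolution_def)
qed

lemma convolution_scale_left:
  "convolution G (\<lambda>\<gamma>. c * f \<gamma>) \<xi> = (\<lambda>\<alpha>. c * convolution G f \<xi> \<alpha>)"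
  by (cases "c = 0") (auto simp: convolution_def sum_distrib_left mult.assoc)

lemma convolution_diff_left:
  assumes "f \<in> group_algebra G" "g \<in> group_algebra G"
  shows "convolution G (\<lambda>\<gamma>. f \<gamma> - g \<gamma>) \<xi> = (\<lambda>\<alpha>. convolution G f \<xi> \<alpha> - convolution G g \<xi> \<alpha>)"
  using convolution_add_left[OF assms(1) group_algebra_scale[OF assms(2), of "-1"], of \<xi>]
    convolution_scale_left[of "-1" g \<xi>] by simp

lemma convolution_add_right:
  "convolution G f (\<lambda>x. \<xi> x + \<eta> x) = (\<lambda>\<alpha>. convolution G f \<xi> \<alpha> + convolution G f \<eta> \<alpha>)"
  by (auto simp: convolution_def sum.distrib distrib_left)

lemma convolution_scale_right:
  "convolution G f (\<lambda>x. c * \<xi> x) = (\<lambda>\<alpha>. c * convolution G f \<xi> \<alpha>)"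
  by (auto simp: convolution_def sum_distrib_left mult.left_commute)

lemma convolution_zero_right: "convolution G f (\<lambda>x. 0) = (\<lambda>\<alpha>. 0)"
  by (auto simp: convolution_def)

lemma convolution_unit_left:
  assumes "\<And>\<alpha>. \<alpha> \<notin> carrier G \<Longrightarrow> \<xi> \<alpha> = 0"
  shows "convolution G (unit_mass G) \<xi> = \<xi>"
proof
  fix \<alpha>
  have "convolution G (unit_mass G) \<xi> \<alpha> = \<xi> \<alpha>" if "\<alpha> \<in> carrier G"
    using that by (subst convolution_superset[of "{\<one>}"]) (auto simp: unit_mass_def)
  then show "convolution G (unit_mass G) \<xi> \<alpha> = \<xi> \<alpha>"
    using assms by (cases "\<alpha> \<in> carrier G") (auto simp: convolution_def)
qed

text \<open>
  Summation over the support of the second factor makes the product visibly continuous in \<open>f\<close> for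
  pointwise convergence, even if the supports of the first factors grow.
\<close>

lemma convolution_flip:
  assumes f: "f \<in> group_algebra G" and F: "finite F" "F \<subseteq> carrier G"
    and \<xi>: "\<And>\<beta>. \<beta> \<notin> F \<Longrightarrow> \<xi> \<beta> = 0" and \<alpha>: "\<alpha> \<in> carrier G"
  shows "convolution G f \<xi> \<alpha> = (\<Sum>\<beta>\<in>F. f (\<alpha> \<otimes> inv \<beta>) * \<xi> \<beta>)"
proof -
  have fin: "finite {\<gamma>. f \<gamma> \<noteq> 0}" using f by (rule group_algebra_finite)
  have car: "\<gamma> \<in> carrier G" if "f \<gamma> \<noteq> 0" for \<gamma> using f that by (auto simp: group_algebra_def)
  have carF: "\<beta> \<in> carrier G" if "\<beta> \<in> F" for \<beta> using F that by auto
  have e1: "\<alpha> \<otimes> inv (inv \<gamma> \<otimes> \<alpha>) = \<gamma>" if "\<gamma> \<in> carrier G" for \<gamma>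
    using that \<alpha> by (simp add: inv_mult_group m_assoc[symmetric])
  have e2: "inv (\<alpha> \<otimes> inv \<beta>) \<otimes> \<alpha> = \<beta>" if "\<beta> \<in> carrier G" for \<beta>
    using that \<alpha> by (simp add: inv_mult_group m_assoc)
  have "(\<Sum>\<gamma> | f \<gamma> \<noteq> 0. f \<gamma> * \<xi> (inv \<gamma> \<otimes> \<alpha>)) = (\<Sum>\<beta>\<in>F. f (\<alpha> \<otimes> inv \<beta>) * \<xi> \<beta>)"
  proof (rule sum.reindex_bij_witness_not_neutral[where
        S' = "{\<gamma>. f \<gamma> \<noteq> 0 \<and> \<xi> (inv \<gamma> \<otimes> \<alpha>) = 0}" and T' = "{\<beta> \<in> F. f (\<alpha> \<otimes> inv \<beta>) * \<xi> \<beta> = 0}"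
        and i = "\<lambda>\<beta>. \<alpha> \<otimes> inv \<beta>" and j = "\<lambda>\<gamma>. inv \<gamma> \<otimes> \<alpha>"])
    show "finite {\<gamma>. f \<gamma> \<noteq> 0 \<and> \<xi> (inv \<gamma> \<otimes> \<alpha>) = 0}" using fin by simp
    show "finite {\<beta> \<in> F. f (\<alpha> \<otimes> inv \<beta>) * \<xi> \<beta> = 0}" using F by simp
    show "inv \<gamma> \<otimes> \<alpha> \<in> F - {\<beta> \<in> F. f (\<alpha> \<otimes> inv \<beta>) * \<xi> \<beta> = 0}"
      if "\<gamma> \<in> {\<gamma>. f \<gamma> \<noteq> 0} - {\<gamma>. f \<gamma> \<noteq> 0 \<and> \<xi> (inv \<gamma> \<otimes> \<alpha>) = 0}" for \<gamma>
      using that \<xi>[of "inv \<gamma> \<otimes> \<alpha>"] car e1 by auto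
  qed (use car carF e1 e2 in auto)
  with \<alpha> show ?thesis by (simp add: convolution_def)
qed

lemma convolution_unit_right:
  assumes "f \<in> group_algebra G"
  shows "convolution G f (unit_mass G) = f"
proof
  fix \<alpha>
  show "convolution G f (unit_mass G) \<alpha> = f \<alpha>"
  proof (cases "\<alpha> \<in> carrier G")
    case True
    then show ?thesis using assms
      by (subst convolution_flip[of f "{\<one>}"]) (auto simp: unit_mass_def)
  qed (use assms in \<open>auto simp: convolution_def group_algebra_outside\<close>)
qed

lemma convolution_support:
  assumes "convolution G f g \<alpha> \<noteq> 0"
  obtains \<sigma> \<tau> where "f \<sigma> \<noteq> 0" "g \<tau> \<noteq> 0" "\<tau> = inv \<sigma> \<otimes> \<alpha>" "\<alpha> \<in> carrier G"
proof -
  have \<alpha>: "\<alpha> \<in> carrier G" using assms by (auto simp: convolution_def split: if_splits)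
  then have "(\<Sum>\<gamma> | f \<gamma> \<noteq> 0. f \<gamma> * g (inv \<gamma> \<otimes> \<alpha>)) \<noteq> 0" using assms by (simp add: convolution_def)
  then obtain \<gamma> where "f \<gamma> * g (inv \<gamma> \<otimes> \<alpha>) \<noteq> 0" "f \<gamma> \<noteq> 0" by (metis (mono_tags, lifting) mem_Collect_eq sum.neutral)
  with \<alpha> that show ?thesis by auto
qed

lemma convolution_support_product:
  assumes f: "f \<in> group_algebra G"
  shows "{\<alpha>. convolution G f g \<alpha> \<noteq> 0} \<subseteq> (\<lambda>(\<sigma>, \<tau>). \<sigma> \<otimes> \<tau>) ` ({\<gamma>. f \<gamma> \<noteq> 0} \<times> {\<gamma>. g \<gamma> \<noteq> 0})"
proof
  fix \<alpha> assume "\<alpha> \<in> {\<alpha>. convolution G f g \<alpha> \<noteq> 0}"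
  then obtain \<sigma> \<tau> where *: "f \<sigma> \<noteq> 0" "g \<tau> \<noteq> 0" "\<tau> = inv \<sigma> \<otimes> \<alpha>" "\<alpha> \<in> carrier G"
    using convolution_support by blast
  then have "\<sigma> \<in> carrier G" using f by (auto simp: group_algebra_def)
  with * have "\<alpha> = \<sigma> \<otimes> \<tau>" by (simp add: m_assoc[symmetric])
  with * show "\<alpha> \<in> (\<lambda>(\<sigma>, \<tau>). \<sigma> \<otimes> \<tau>) ` ({\<gamma>. f \<gamma> \<noteq> 0} \<times> {\<gamma>. g \<gamma> \<noteq> 0})" by force
qed

lemma convolution_group_algebra:
  assumes f: "f \<in> group_algebra G" and g: "g \<in> group_algebra G"
  shows "convolution G f g \<in> group_algebra G"
proof (rule group_algebraI)
  show "finite ((\<lambda>(\<sigma>, \<tau>). \<sigma> \<otimes> \<tau>) ` ({\<gamma>. f \<gamma> \<noteq> 0} \<times> {\<gamma>. g \<gamma> \<noteq> 0}))"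
    using f g by (simp add: group_algebra_def)
  show "(\<lambda>(\<sigma>, \<tau>). \<sigma> \<otimes> \<tau>) ` ({\<gamma>. f \<gamma> \<noteq> 0} \<times> {\<gamma>. g \<gamma> \<noteq> 0}) \<subseteq> carrier G"
    using f g by (auto simp: group_algebra_def subset_iff)
qed (use convolution_support_product[OF f, of g] in blast)

lemma convolution_assoc:
  assumes f: "f \<in> group_algebra G" and g: "g \<in> group_algebra G"
  shows "convolution G (convolution G f g) \<xi> = convolution G f (convolution G g \<xi>)"
proof
  fix \<alpha>
  show "convolution G (convolution G f g) \<xi> \<alpha> = convolution G f (convolution G g \<xi>) \<alpha>"
  proof (cases "\<alpha> \<in> carrier G")
    case \<alpha>: True
    define S where "S = {\<gamma>. f \<gamma> \<noteq> 0}"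
    define T where "T = {\<gamma>. g \<gamma> \<noteq> 0}"
    \<comment> \<open>a finite set that contains the support of \<open>convolution G f g\<close>\<close>
    define W where "W = (\<lambda>(\<sigma>, \<tau>). \<sigma> \<otimes> \<tau>) ` (S \<times> T)"
    have fin: "finite S" "finite T" "finite W"
      using f g by (simp_all add: S_def T_def W_def group_algebra_def)
    have car: "S \<subseteq> carrier G" "T \<subseteq> carrier G"
      using f g by (simp_all add: S_def T_def group_algebra_def)
    then have carW: "W \<subseteq> carrier G" by (auto simp: W_def subset_iff)
    have inner: "(\<Sum>\<gamma>\<in>W. g (inv \<sigma> \<otimes> \<gamma>) * \<xi> (inv \<gamma> \<otimes> \<alpha>)) = convolution G g \<xi> (inv \<sigma> \<otimes> \<alpha>)" if "\<sigma> \<in> S" for \<sigma>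
    proof -
      have \<sigma>: "\<sigma> \<in> carrier G" using that car by auto
      have inj: "inj_on (\<lambda>\<tau>. \<sigma> \<otimes> \<tau>) T" using \<sigma> car by (auto simp: inj_on_def subset_iff)
      have sub: "(\<lambda>\<tau>. \<sigma> \<otimes> \<tau>) ` T \<subseteq> W" using that by (auto simp: W_def)
      have "(\<Sum>\<gamma>\<in>W. g (inv \<sigma> \<otimes> \<gamma>) * \<xi> (inv \<gamma> \<otimes> \<alpha>))
          = (\<Sum>\<gamma>\<in>(\<lambda>\<tau>. \<sigma> \<otimes> \<tau>) ` T. g (inv \<sigma> \<otimes> \<gamma>) * \<xi> (inv \<gamma> \<otimes> \<alpha>))"
      proof (rule sum.mono_neutral_right[OF fin(3) sub], safe)
        fix \<gamma> assume \<gamma>: "\<gamma> \<in> W" "\<gamma> \<notin> (\<lambda>\<tau>. \<sigma> \<otimes> \<tau>) ` T"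
        have "\<gamma> = \<sigma> \<otimes> (inv \<sigma> \<otimes> \<gamma>)" using \<sigma> \<gamma> carW by (auto simp: m_assoc[symmetric])
        then have "inv \<sigma> \<otimes> \<gamma> \<notin> T" using \<gamma>(2) by blast
        then show "g (inv \<sigma> \<otimes> \<gamma>) * \<xi> (inv \<gamma> \<otimes> \<alpha>) = 0" by (simp add: T_def)
      qed
      also have "\<dots> = (\<Sum>\<tau>\<in>T. g \<tau> * \<xi> (inv \<tau> \<otimes> (inv \<sigma> \<otimes> \<alpha>)))"
        unfolding sum.reindex[OF inj] o_def
      proof (rule sum.cong[OF refl])
        fix \<tau> assume "\<tau> \<in> T"
        then have \<tau>: "\<tau> \<in> carrier G" using car by auto
        show "g (inv \<sigma> \<otimes> (\<sigma> \<otimes> \<tau>)) * \<xi> (inv (\<sigma> \<otimes> \<tau>) \<otimes> \<alpha>) = g \<tau> * \<xi> (inv \<tau> \<otimes> (inv \<sigma> \<otimes> \<alpha>))"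
          using \<sigma> \<tau> \<alpha> by (simp add: inv_mult_group m_assoc[symmetric])
      qed
      finally show ?thesis using \<sigma> \<alpha> by (simp add: convolution_def T_def)
    qed
    have "convolution G (convolution G f g) \<xi> \<alpha> = (\<Sum>\<gamma>\<in>W. convolution G f g \<gamma> * \<xi> (inv \<gamma> \<otimes> \<alpha>))"
      using convolution_support_product[OF f, of g] fin \<alpha>
      by (intro convolution_superset) (auto simp: W_def S_def T_def)
    also have "\<dots> = (\<Sum>\<gamma>\<in>W. \<Sum>\<sigma>\<in>S. f \<sigma> * (g (inv \<sigma> \<otimes> \<gamma>) * \<xi> (inv \<gamma> \<otimes> \<alpha>)))"
      using carW by (intro sum.cong) (auto simp: convolution_def S_def sum_distrib_right mult.assoc)
    also have "\<dots> = (\<Sum>\<sigma>\<in>S. \<Sum>\<gamma>\<in>W. f \<sigma> * (g (inv \<sigma> \<otimes> \<gamma>) * \<xi> (inv \<gamma> \<otimes> \<alpha>)))"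
      by (rule sum.swap)
    also have "\<dots> = (\<Sum>\<sigma>\<in>S. f \<sigma> * convolution G g \<xi> (inv \<sigma> \<otimes> \<alpha>))"
      by (intro sum.cong) (auto simp: inner sum_distrib_left[symmetric])
    finally show ?thesis using \<alpha> by (simp add: convolution_def S_def)
  qed (simp add: convolution_def)
qed

end

section \<open>Norms of convolution operators\<close>

definition convolution_norm :: "ennreal \<Rightarrow> ('g, 'm) monoid_scheme \<Rightarrow> ('g \<Rightarrow> complex) \<Rightarrow> real" where
  "convolution_norm p G f = operator_norm p (carrier G) (regular_rep p G f)"

context group
begin

lemma carrier_nonempty: "carrier G \<noteq> {}"
  using one_closed by blast

lemma bij_betw_left_translation:
  "\<gamma> \<in> carrier G \<Longrightarrow> bij_betw (\<lambda>\<alpha>. inv \<gamma> \<otimes> \<alpha>) (carrier G) (carrier G)"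
  by (rule bij_betw_byWitness[where f' = "\<lambda>\<alpha>. \<gamma> \<otimes> \<alpha>"]) (auto simp: m_assoc[symmetric])

lemma lp_bounded_convolution:
  assumes f: "f \<in> group_algebra G" and p: "1 \<le> p" and C: "0 \<le> C"
    and \<xi>: "lp_bounded p (carrier G) C \<xi>"
  shows "lp_bounded p (carrier G) ((\<Sum>\<gamma> | f \<gamma> \<noteq> 0. cmod (f \<gamma>)) * C) (convolution G f \<xi>)"
proof -
  let ?tr = "\<lambda>\<gamma> \<alpha>. if \<alpha> \<in> carrier G then \<xi> (inv \<gamma> \<otimes> \<alpha>) else 0"
  have "lp_bounded p (carrier G) (\<Sum>\<gamma> | f \<gamma> \<noteq> 0. cmod (f \<gamma>) * C) (\<lambda>\<alpha>. \<Sum>\<gamma> | f \<gamma> \<noteq> 0. f \<gamma> * ?tr \<gamma> \<alpha>)"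
  proof (rule lp_bounded_sum[OF p group_algebra_finite[OF f]])
    fix \<gamma> assume "\<gamma> \<in> {\<gamma>. f \<gamma> \<noteq> 0}"
    then have "\<gamma> \<in> carrier G" using group_algebra_carrier[OF f] by blast
    then have "lp_bounded p (carrier G) C (?tr \<gamma>)"
      by (intro lp_bounded_bij[OF \<xi> bij_betw_left_translation]) auto
    then show "lp_bounded p (carrier G) (cmod (f \<gamma>) * C) (\<lambda>\<alpha>. f \<gamma> * ?tr \<gamma> \<alpha>)"
      by (rule lp_bounded_scale[OF _ C])
  qed (use C in auto)
  moreover have "(\<lambda>\<alpha>. \<Sum>\<gamma> | f \<gamma> \<noteq> 0. f \<gamma> * ?tr \<gamma> \<alpha>) = convolution G f \<xi>"
    by (auto simp: convolution_def)
  ultimately show ?thesis by (simp add: sum_distrib_right)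
qed

lemma regular_rep_bounded:
  assumes f: "f \<in> group_algebra G" and p: "1 \<le> p"
  shows "regular_rep p G f \<in> bounded_operators p (carrier G)"
proof -
  have "regular_rep p G f = restrict (convolution G f) (lp_space p (carrier G))"
    by (rule ext) (simp add: regular_rep_eq[symmetric], simp add: regular_rep_def)
  moreover have "restrict (convolution G f) (lp_space p (carrier G)) \<in> bounded_operators p (carrier G)"
    by (rule bounded_operatorsI[OF p carrier_nonempty, of "\<Sum>\<gamma> | f \<gamma> \<noteq> 0. cmod (f \<gamma>)"])
      (auto intro!: sum_nonneg lp_bounded_convolution f p lp_norm_nonneg carrier_nonempty lp_bounded_norm
        simp: convolution_add_right convolution_scale_right)
  ultimately show ?thesis by simp
qed

lemma convolution_norm_nonneg:
  "f \<in> group_algebra G \<Longrightarrow> 1 \<le> p \<Longrightarrow> 0 \<le> convolution_norm p G f"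
  unfolding convolution_norm_def by (intro operator_norm_nonneg regular_rep_bounded carrier_nonempty)

lemma lp_bounded_convolution_norm:
  assumes f: "f \<in> group_algebra G" and p: "1 \<le> p" and C: "0 \<le> C"
    and \<xi>: "lp_bounded p (carrier G) C \<xi>"
  shows "lp_bounded p (carrier G) (convolution_norm p G f * C) (convolution G f \<xi>)"
  using lp_bounded_operator_norm[OF regular_rep_bounded[OF f p] carrier_nonempty p C \<xi>] \<xi>
    lp_bounded_iff[OF p carrier_nonempty C, of \<xi>]
  by (simp add: convolution_norm_def regular_rep_eq)

lemma convolution_norm_le:
  assumes p: "1 \<le> p" and K: "0 \<le> K"
    and le: "\<And>\<xi> C. 0 \<le> C \<Longrightarrow> lp_bounded p (carrier G) C \<xi> \<Longrightarrow> lp_bounded p (carrier G) (K * C) (convolution G f \<xi>)"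
  shows "convolution_norm p G f \<le> K"
  unfolding convolution_norm_def
proof (rule operator_norm_le[OF carrier_nonempty p K])
  fix \<xi> assume \<xi>: "\<xi> \<in> lp_space p (carrier G)"
  show "lp_bounded p (carrier G) (K * lp_norm p (carrier G) \<xi>) (regular_rep p G f \<xi>)"
    unfolding regular_rep_eq[OF \<xi>]
    by (intro le lp_norm_nonneg lp_bounded_norm carrier_nonempty p \<xi>)
qed

lemma convolution_norm_add:
  assumes p: "1 \<le> p" and fg: "f \<in> group_algebra G" "g \<in> group_algebra G"
  shows "convolution_norm p G (\<lambda>\<gamma>. f \<gamma> + g \<gamma>) \<le> convolution_norm p G f + convolution_norm p G g"
  by (rule convolution_norm_le[OF p])
    (auto simp: convolution_add_left fg distrib_right convolution_norm_nonneg p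
      intro!: lp_bounded_add lp_bounded_convolution_norm add_nonneg_nonneg mult_nonneg_nonneg)

lemma convolution_norm_scale:
  assumes p: "1 \<le> p" and f: "f \<in> group_algebra G"
  shows "convolution_norm p G (\<lambda>\<gamma>. c * f \<gamma>) \<le> cmod c * convolution_norm p G f"
  by (rule convolution_norm_le[OF p])
    (auto simp: convolution_scale_left f mult.assoc convolution_norm_nonneg p
      intro!: lp_bounded_scale lp_bounded_convolution_norm mult_nonneg_nonneg)

lemma convolution_norm_mult:
  assumes p: "1 \<le> p" and fg: "f \<in> group_algebra G" "g \<in> group_algebra G"
  shows "convolution_norm p G (convolution G f g) \<le> convolution_norm p G f * convolution_norm p G g"
  by (rule convolution_norm_le[OF p])
    (auto simp: convolution_assoc fg mult.assoc convolution_norm_nonneg p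
      intro!: lp_bounded_convolution_norm mult_nonneg_nonneg)

lemma convolution_norm_unit:
  assumes p: "1 \<le> p"
  shows "convolution_norm p G (unit_mass G) \<le> 1"
  by (rule convolution_norm_le[OF p]) (auto simp: convolution_unit_left lp_bounded_outside)

lemma lp_bounded_unit_mass:
  assumes p: "1 \<le> p"
  shows "lp_bounded p (carrier G) 1 (unit_mass G)"
proof -
  have "(\<Sum>x\<in>F. cmod (unit_mass G x)) \<le> 1" if "finite F" for F
  proof -
    have "(\<Sum>x\<in>F. cmod (unit_mass G x)) = (\<Sum>x\<in>F. if x = \<one> then 1 else 0)"
      by (rule sum.cong) (auto simp: unit_mass_def)
    with that show ?thesis by simp
  qed
  then have "lp_bounded 1 (carrier G) 1 (unit_mass G)"
    by (auto simp: lp_bounded_def unit_mass_def)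
  then show ?thesis by (rule lp_bounded_exponent_mono[OF _ p, rotated 2]) auto
qed

lemma lp_bounded_self:
  assumes p: "1 \<le> p" and f: "f \<in> group_algebra G"
  shows "lp_bounded p (carrier G) (convolution_norm p G f) f"
  using lp_bounded_convolution_norm[OF f p zero_le_one lp_bounded_unit_mass[OF p]]
  by (simp add: convolution_unit_right[OF f])

lemma bij_betw_inv: "bij_betw (\<lambda>\<alpha>. inv \<alpha>) (carrier G) (carrier G)"
  by (rule bij_betw_byWitness[where f' = "\<lambda>\<alpha>. inv \<alpha>"]) auto

text \<open>
  The comparison of norms on which the transfer between exponents rests, by evaluation on one test vector.

  If \<open>p \<le> 2\<close>, convolution by \<open>f\<close> maps the unit mass to \<open>f\<close>, and the \<open>\<ell>\<^sup>2\<close> norm is at most the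
  \<open>\<ell>\<^sup>p\<close> norm. If \<open>p \<ge> 2\<close>, the test vector is \<open>\<eta> \<alpha> = cnj (f (inv \<alpha>))\<close>: the value of
  \<open>convolution G f \<eta>\<close> at the unit is the square of the \<open>\<ell>\<^sup>2\<close> norm \<open>s\<close> of \<open>f\<close>, while the
  \<open>\<ell>\<^sup>p\<close> norm of \<open>\<eta>\<close> is at most its \<open>\<ell>\<^sup>2\<close> norm, which is \<open>s\<close>. One factor \<open>s\<close> cancels.
\<close>

lemma lp_bounded_2_self:
  assumes p: "1 \<le> p" and f: "f \<in> group_algebra G"
  shows "lp_bounded 2 (carrier G) (convolution_norm p G f) f"
proof (cases "p \<le> 2")
  case True
  then show ?thesis
    using lp_bounded_exponent_mono[OF p True convolution_norm_nonneg[OF f p] lp_bounded_self[OF p f]] by simp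
next
  case False
  then have p2: "2 \<le> p" by simp
  define S where "S = {\<gamma>. f \<gamma> \<noteq> 0}"
  define s where "s = sqrt (\<Sum>\<gamma>\<in>S. (cmod (f \<gamma>))\<^sup>2)"
  have S: "finite S" "S \<subseteq> carrier G" using f by (auto simp: S_def group_algebra_def)
  have s: "0 \<le> s" "s\<^sup>2 = (\<Sum>\<gamma>\<in>S. (cmod (f \<gamma>))\<^sup>2)" by (auto simp: s_def sum_nonneg)
  have f2: "lp_bounded 2 (carrier G) s f"
  proof -
    have "(\<Sum>x\<in>F. (cmod (f x))\<^sup>2) \<le> s\<^sup>2" if "finite F" for F
    proof -
      have "(\<Sum>x\<in>F. (cmod (f x))\<^sup>2) = (\<Sum>x\<in>F \<inter> S. (cmod (f x))\<^sup>2)"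
        using that by (intro sum.mono_neutral_right) (auto simp: S_def)
      also have "\<dots> \<le> s\<^sup>2" unfolding s using S by (intro sum_mono2) auto
      finally show ?thesis .
    qed
    then show ?thesis using f s(1)
      by (auto simp: lp_bounded_def group_algebra_outside)
  qed
  define \<eta> where "\<eta> = (\<lambda>\<alpha>. if \<alpha> \<in> carrier G then cnj (f (inv \<alpha>)) else 0)"
  have "lp_bounded 2 (carrier G) s \<eta>"
    by (rule lp_bounded_bij[OF f2 bij_betw_inv]) (auto simp: \<eta>_def)
  then have "lp_bounded p (carrier G) s \<eta>"
    by (rule lp_bounded_exponent_mono[OF _ p2 s(1), rotated]) auto
  then have *: "lp_bounded p (carrier G) (convolution_norm p G f * s) (convolution G f \<eta>)"
    by (rule lp_bounded_convolution_norm[OF f p s(1)])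
  have "convolution G f \<eta> \<one> = (\<Sum>\<gamma>\<in>S. f \<gamma> * cnj (f \<gamma>))"
    using S by (auto simp: convolution_def S_def \<eta>_def intro!: sum.cong)
  also have "\<dots> = complex_of_real (s\<^sup>2)"
    unfolding s by (simp only: of_real_sum complex_norm_square)
  finally have "cmod (convolution G f \<eta> \<one>) = s\<^sup>2" by (simp only: norm_of_real abs_power2)
  then have "s\<^sup>2 \<le> convolution_norm p G f * s"
    using lp_bounded_coordinate[OF p _ *, of "\<one>"] s(1) convolution_norm_nonneg[OF f p] by simp
  then have "s \<le> convolution_norm p G f"
    using s(1) convolution_norm_nonneg[OF f p] by (cases "s = 0") (auto simp: power2_eq_square)
  with f2 s(1) show ?thesis by (rule lp_bounded_mono)
qed

lemma lp_norm_2_le_convolution_norm: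
  assumes p: "1 \<le> p" and f: "f \<in> group_algebra G"
  shows "lp_norm 2 (carrier G) f \<le> convolution_norm p G f"
  using lp_bounded_2_self[OF assms] lp_bounded_iff[OF _ carrier_nonempty convolution_norm_nonneg[OF f p], of 2 f]
  by simp

text \<open>
  Lower semicontinuity of the convolution norm under pointwise convergence of the coefficients.
  Since \<open>g\<close> has finite support, finitely many values of \<open>convolution G g \<xi>\<close> depend on finitely many
  values of \<open>\<xi>\<close>. So \<open>\<xi>\<close> may be truncated to a finite set, and on truncated vectors convolution is
  continuous in its first factor. Density of the finitely supported vectors, false for \<open>p = \<infinity>\<close>,
  is replaced by this locality of convolution by \<open>g\<close>.
\<close>

lemma convolution_norm_limit:
  assumes p: "1 \<le> p" and C: "0 \<le> C"
    and f: "\<And>n. f n \<in> group_algebra G" "\<And>n. convolution_norm p G (f n) \<le> C"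
    and g: "g \<in> group_algebra G" and lim: "\<And>\<gamma>. (\<lambda>n. f n \<gamma>) \<longlonglongrightarrow> g \<gamma>"
  shows "convolution_norm p G g \<le> C"
proof (rule convolution_norm_le[OF p C])
  fix \<xi> D assume D: "0 \<le> D" and \<xi>: "lp_bounded p (carrier G) D \<xi>"
  have CD: "0 \<le> C * D" using C D by simp
  show "lp_bounded p (carrier G) (C * D) (convolution G g \<xi>)"
  proof (rule lp_bounded_local)
    fix F assume F: "finite F" "F \<subseteq> carrier G"
    define S where "S = {\<gamma>. g \<gamma> \<noteq> 0}"
    have S: "finite S" "S \<subseteq> carrier G" using g by (auto simp: S_def group_algebra_def)
    \<comment> \<open>the points of which \<open>convolution G g \<xi>\<close> reads the value of \<open>\<xi>\<close> when evaluated on \<open>F\<close>\<close>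
    define H where "H = (\<lambda>(\<gamma>, \<alpha>). inv \<gamma> \<otimes> \<alpha>) ` (S \<times> F)"
    have H: "finite H" "H \<subseteq> carrier G" using F S by (auto simp: H_def subset_iff)
    define \<eta> where "\<eta> = (\<lambda>\<beta>. if \<beta> \<in> H then \<xi> \<beta> else 0)"
    have \<eta>: "lp_bounded p (carrier G) D \<eta>"
      by (rule lp_bounded_dominated[OF \<xi>]) (simp add: \<eta>_def)
    have "lp_bounded p (carrier G) (C * D) (convolution G g \<eta>)"
    proof (rule lp_bounded_limit[OF CD p, of "carrier G" "\<lambda>n. convolution G (f n) \<eta>"])
      fix \<alpha> assume \<alpha>: "\<alpha> \<in> carrier G"
      have e: "convolution G h \<eta> \<alpha> = (\<Sum>\<beta>\<in>H. h (\<alpha> \<otimes> inv \<beta>) * \<eta> \<beta>)" if "h \<in> group_algebra G" for h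
        by (rule convolution_flip[OF that H _ \<alpha>]) (simp add: \<eta>_def)
      show "(\<lambda>n. convolution G (f n) \<eta> \<alpha>) \<longlonglongrightarrow> convolution G g \<eta> \<alpha>"
        unfolding e[OF f(1)] e[OF g] by (intro tendsto_sum tendsto_mult lim tendsto_const)
    next
      have "lp_bounded p (carrier G) (C * D) (convolution G (f n) \<eta>)" for n
        by (rule lp_bounded_mono[OF lp_bounded_convolution_norm[OF f(1) p D \<eta>]])
          (use f D p in \<open>auto intro!: mult_right_mono mult_nonneg_nonneg convolution_norm_nonneg\<close>)
      then show "\<forall>\<^sub>F n in sequentially. lp_bounded p (carrier G) (C * D) (convolution G (f n) \<eta>)"
        by simp
    qed (simp add: convolution_def)
    moreover have "convolution G g \<eta> \<alpha> = convolution G g \<xi> \<alpha>" if "\<alpha> \<in> F" for \<alpha>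
    proof -
      have "\<eta> (inv \<gamma> \<otimes> \<alpha>) = \<xi> (inv \<gamma> \<otimes> \<alpha>)" if "g \<gamma> \<noteq> 0" for \<gamma>
        using that \<open>\<alpha> \<in> F\<close> by (force simp: \<eta>_def H_def S_def)
      then show ?thesis by (auto simp: convolution_def intro!: sum.cong)
    qed
    ultimately show "\<exists>\<zeta>. lp_bounded p (carrier G) (C * D) \<zeta> \<and> (\<forall>\<alpha>\<in>F. \<zeta> \<alpha> = convolution G g \<xi> \<alpha>)"
      by blast
  qed (simp add: convolution_def)
qed

end

section \<open>Polynomials in an element of the group algebra\<close>

text \<open>
  Evaluation of a polynomial at \<open>b\<close> by Horner's rule. Complex polynomials form a commutative ring
  type, so identities between polynomials in \<open>b\<close> become ordinary ring identities.
\<close>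

definition poly_convolution ::
    "('g, 'm) monoid_scheme \<Rightarrow> ('g \<Rightarrow> complex) \<Rightarrow> complex poly \<Rightarrow> 'g \<Rightarrow> complex" where
  "poly_convolution G b q =
     fold_coeffs (\<lambda>a g \<gamma>. a * unit_mass G \<gamma> + convolution G b g \<gamma>) q (\<lambda>\<gamma>. 0)"

context group
begin

lemma poly_convolution_0 [simp]: "poly_convolution G b 0 = (\<lambda>\<gamma>. 0)"
  by (simp add: poly_convolution_def)

lemma poly_convolution_pCons [simp]:
  "poly_convolution G b (pCons a q) = (\<lambda>\<gamma>. a * unit_mass G \<gamma> + convolution G b (poly_convolution G b q) \<gamma>)"
proof (cases "a = 0 \<and> q = 0")
  case False
  then show ?thesis by (cases "a = 0") (auto simp: poly_convolution_def)
qed (simp add: convolution_zero_right)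

context
  fixes b assumes b: "b \<in> group_algebra G"
begin

lemma poly_convolution_group_algebra: "poly_convolution G b q \<in> group_algebra G"
  by (induction q) (auto intro!: group_algebra_zero group_algebra_add group_algebra_scale
      unit_mass_group_algebra convolution_group_algebra b)

lemma poly_convolution_add:
  "poly_convolution G b (q + r) = (\<lambda>\<gamma>. poly_convolution G b q \<gamma> + poly_convolution G b r \<gamma>)"
  by (induction q r rule: poly_induct2) (auto simp: convolution_add_right algebra_simps)

lemma poly_convolution_smult:
  "poly_convolution G b (smult c q) = (\<lambda>\<gamma>. c * poly_convolution G b q \<gamma>)"
  by (induction q) (auto simp: convolution_scale_right algebra_simps)

lemma poly_convolution_minus:
  "poly_convolution G b (- q) = (\<lambda>\<gamma>. (-1) * poly_convolution G b q \<gamma>)"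
  using poly_convolution_smult[of "-1" q] by simp

lemma poly_convolution_diff:
  "poly_convolution G b (q - r) = (\<lambda>\<gamma>. poly_convolution G b q \<gamma> - poly_convolution G b r \<gamma>)"
  using poly_convolution_add[of q "- r"] by (simp add: poly_convolution_minus)

lemma poly_convolution_mult:
  "poly_convolution G b (q * r) = convolution G (poly_convolution G b q) (poly_convolution G b r)"
proof (induction q)
  case 0
  show ?case by (auto simp: convolution_def)
next
  case (pCons a q)
  let ?e = "poly_convolution G b"
  have "?e (pCons a q * r) = (\<lambda>\<gamma>. a * ?e r \<gamma> + convolution G b (convolution G (?e q) (?e r)) \<gamma>)"
    by (simp add: poly_convolution_add poly_convolution_smult pCons.IH)
  also have "\<dots> = convolution G (?e (pCons a q)) (?e r)"
    using group_algebra_outside[OF poly_convolution_group_algebra]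
    by (simp add: convolution_add_left group_algebra_scale unit_mass_group_algebra b
        convolution_group_algebra poly_convolution_group_algebra convolution_scale_left
        convolution_unit_left convolution_assoc)
  finally show ?case .
qed

lemma poly_convolution_1: "poly_convolution G b 1 = unit_mass G"
  by (simp add: one_pCons convolution_zero_right)

lemma poly_convolution_X: "poly_convolution G b [:0, 1:] = b"
  by (simp add: convolution_zero_right convolution_unit_right b)

text \<open>
  The degree of a polynomial controls the length of the group elements in the support of its value;
  this is where lengths enter, since rapid decay is only available on balls.
\<close>

lemma poly_convolution_support:
  assumes l: "length_function G l" and m: "{\<gamma>. b \<gamma> \<noteq> 0} \<subseteq> length_ball G l m"
  shows "degree q \<le> d \<Longrightarrow> {\<gamma>. poly_convolution G b q \<gamma> \<noteq> 0} \<subseteq> length_ball G l (m * d)"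
proof (induction q arbitrary: d)
  case (pCons a q)
  have "\<gamma> \<in> length_ball G l (m * d)" if \<gamma>: "poly_convolution G b (pCons a q) \<gamma> \<noteq> 0" for \<gamma>
  proof -
    consider "\<gamma> = \<one>" | "convolution G b (poly_convolution G b q) \<gamma> \<noteq> 0"
      using \<gamma> by (cases "\<gamma> = \<one>") (auto simp: unit_mass_def)
    then show ?thesis
    proof cases
      case 1
      have "l \<one> = 0" using l by (auto simp: length_function_def)
      with 1 show ?thesis by (simp add: length_ball_def)
    next
      case 2
      then have "q \<noteq> 0" by (auto simp: convolution_zero_right)
      then obtain d' where d: "d = Suc d'" "degree q \<le> d'"
        using pCons.prems by (cases d) auto
      obtain \<sigma> \<tau> where *: "b \<sigma> \<noteq> 0" "poly_convolution G b q \<tau> \<noteq> 0" "\<tau> = inv \<sigma> \<otimes> \<gamma>" "\<gamma> \<in> carrier G"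
        using convolution_support[OF 2] by metis
      have \<sigma>: "\<sigma> \<in> carrier G" "l \<sigma> \<le> m" using * m by (auto simp: length_ball_def)
      have \<tau>: "\<tau> \<in> carrier G" "l \<tau> \<le> m * d'" using * pCons.IH[OF d(2)] by (auto simp: length_ball_def)
      have "\<gamma> = \<sigma> \<otimes> \<tau>" using * \<sigma> by (simp add: m_assoc[symmetric])
      then have "l \<gamma> \<le> l \<sigma> + l \<tau>" using l \<sigma> \<tau> by (simp add: length_function_def)
      with \<sigma> \<tau> d *(4) show ?thesis by (simp add: length_ball_def algebra_simps)
    qed
  qed
  then show ?case by blast
qed simp

end

end

section \<open>Iteration towards an idempotent\<close>

text \<open>
  The map \<open>v \<mapsto> 3 v\<^sup>2 - 2 v\<^sup>3\<close> has \<open>0\<close> and \<open>1\<close> as superattracting fixed points. The defect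
  \<open>c = v - v\<^sup>2\<close> becomes \<open>c\<^sup>2 (3 + 4 c)\<close>, so for defects of norm at most \<open>1\<close> its norm is at most
  \<open>7\<close> times the square of the old one. This gives doubly exponential decay. The increment of \<open>v\<close> is
  \<open>c (2 v - 1)\<close>, which decays at the same rate as long as \<open>v\<close> stays bounded. The function \<open>N\<close> is any
  submultiplicative seminorm.
\<close>

lemma idempotent_iteration:
  fixes N :: "'a::comm_ring_1 \<Rightarrow> real" and u :: "nat \<Rightarrow> 'a"
  assumes nonneg: "\<And>x. 0 \<le> N x" and add: "\<And>x y. N (x + y) \<le> N x + N y"
    and zero: "N 0 = 0"
    and mult: "\<And>x y. N (x * y) \<le> N x * N y" and minus: "\<And>x. N (- x) \<le> N x" and one: "N 1 \<le> 1"
    and step: "\<And>n. u (Suc n) = u n * u n * (3 - 2 * u n)"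
    and r: "7 * N (u 0 - u 0 * u 0) \<le> r" "r \<le> 1 / (8 * (N (u 0) + 1))"
  shows "7 * N (u n - u n * u n) \<le> r ^ (2 ^ n)"
    and "N (u n - u 0) \<le> 1 / 8"
    and "N (u (Suc n) - u n) \<le> (2 * N (u 0) + 2) * r ^ (2 ^ n)"
proof -
  define M where "M = N (u 0)"
  have M: "0 \<le> M" by (simp add: M_def nonneg)
  have r0: "0 \<le> r" using r(1) nonneg[of "u 0 - u 0 * u 0"] by linarith
  have rM: "r * (M + 1) \<le> 1 / 8" using r(2) M by (simp add: M_def field_simps)
  have "r * 1 \<le> r * (M + 1)" using r0 M by (intro mult_left_mono) auto
  with rM have r8: "r \<le> 1 / 8" by simp
  define c where "c n = u n - u n * u n" for n
  have two: "N (2 * x) \<le> 2 * N x" for x using add[of x x] unfolding mult_2 .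
  have N3: "N 3 \<le> 3"
  proof -
    have "N (1 + (1 + 1)) \<le> 3" using add[of 1 "1 + 1"] add[of 1 1] one by linarith
    then show ?thesis by simp
  qed
  have "v * v * (3 - 2 * v) - (v * v * (3 - 2 * v)) * (v * v * (3 - 2 * v))
      = (v - v * v) * (v - v * v) * (3 + 2 * (2 * (v - v * v)))" for v :: 'a
    by (simp add: algebra_simps)
  then have cSuc: "c (Suc n) = c n * c n * (3 + 2 * (2 * c n))" for n
    unfolding c_def step by blast
  have "v * v * (3 - 2 * v) - v = (v - v * v) * (2 * v + - 1)" for v :: 'a
    by (simp add: algebra_simps)
  then have uSuc: "u (Suc n) - u n = c n * (2 * u n + - 1)" for n
    unfolding c_def step by blast
  have c7: "7 * N (c n) \<le> r ^ (2 ^ n)" for n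
  proof (induction n)
    case 0 show ?case using r by (simp add: c_def)
  next
    case (Suc n)
    have "r ^ (2 ^ n) \<le> 1" using r0 r8 by (intro power_le_one) auto
    with Suc have le1: "N (c n) \<le> 1" by simp
    have "N (3 + 2 * (2 * c n)) \<le> 7"
      using add[of 3 "2 * (2 * c n)"] two[of "2 * c n"] two[of "c n"] N3 le1 by linarith
    then have "N (c (Suc n)) \<le> N (c n) * N (c n) * 7"
      unfolding cSuc using mult[of "c n" "c n"] mult[of "c n * c n" "3 + 2 * (2 * c n)"]
      by (meson mult_mono nonneg order_trans zero_le_mult_iff)
    then have "7 * N (c (Suc n)) \<le> (7 * N (c n))\<^sup>2" by (simp add: power2_eq_square)
    also have "\<dots> \<le> (r ^ (2 ^ n))\<^sup>2" using Suc nonneg by (intro power_mono) auto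
    finally show ?case by (simp add: power_mult[symmetric] mult.commute)
  qed
  then show "7 * N (u n - u n * u n) \<le> r ^ (2 ^ n)" by (simp add: c_def)
  have diff: "N (u (Suc n) - u n) \<le> r ^ (2 ^ n) / 7 * (2 * M + 2)" if "N (u n - u 0) \<le> 1 / 8" for n
  proof -
    have "N (u n) \<le> M + 1 / 8" using add[of "u n - u 0" "u 0"] that by (simp add: M_def)
    then have "N (2 * u n + - 1) \<le> 2 * M + 2"
      using add[of "2 * u n" "- 1"] two[of "u n"] minus[of 1] one by linarith
    then have "N (c n) * N (2 * u n + - 1) \<le> r ^ (2 ^ n) / 7 * (2 * M + 2)"
      using c7[of n] nonneg r0 by (intro mult_mono) auto
    then show ?thesis unfolding uSuc using mult[of "c n" "2 * u n + - 1"] by linarith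
  qed
  \<comment> \<open>the weight \<open>1 - (1 / 2) ^ n\<close> matches increments that are at most \<open>(1 / 2) ^ n / 16\<close>\<close>
  have near: "N (u n - u 0) \<le> (1 - (1 / 2) ^ n) / 8" for n
  proof (induction n)
    case 0
    show ?case using zero by simp
  next
    case (Suc n)
    moreover have "(1 - (1 / 2) ^ n) / 8 \<le> (1 / 8 :: real)" by simp
    ultimately have "N (u n - u 0) \<le> 1 / 8" by (rule order_trans)
    from diff[OF this] have d: "N (u (Suc n) - u n) \<le> r ^ (2 ^ n) / 7 * (2 * M + 2)" .
    have "r ^ (2 ^ n) \<le> r ^ Suc n" using r0 r8 by (intro power_decreasing) (auto simp: Suc_le_eq)
    also have "\<dots> \<le> r * (1 / 2) ^ n" using r0 r8 by (auto intro!: mult_left_mono power_mono)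
    finally have "r ^ (2 ^ n) * (M + 1) \<le> r * (1 / 2) ^ n * (M + 1)" using M by (intro mult_right_mono) auto
    also have "\<dots> = r * (M + 1) * (1 / 2) ^ n" by simp
    also have "\<dots> \<le> 1 / 8 * (1 / 2) ^ n" using rM by (intro mult_right_mono) auto
    finally have "r ^ (2 ^ n) * (M + 1) \<le> 1 / 8 * (1 / 2) ^ n" .
    moreover have "r ^ (2 ^ n) / 7 * (2 * M + 2) = 2 / 7 * (r ^ (2 ^ n) * (M + 1))"
      by (simp add: algebra_simps)
    moreover have "0 \<le> (1 / 2 :: real) ^ n" by simp
    ultimately have "N (u (Suc n) - u n) \<le> (1 / 2) ^ n / 16" using d by linarith
    moreover have "N (u (Suc n) - u 0) \<le> N (u (Suc n) - u n) + N (u n - u 0)"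
      using add[of "u (Suc n) - u n" "u n - u 0"] by simp
    ultimately have "N (u (Suc n) - u 0) \<le> (1 / 2) ^ n / 16 + (1 - (1 / 2) ^ n) / 8"
      using Suc by linarith
    also have "\<dots> = (1 - (1 / 2) ^ Suc n) / 8" by (simp add: field_simps)
    finally show ?case .
  qed
  show le: "N (u n - u 0) \<le> 1 / 8" for n
    by (rule order_trans[OF near]) simp
  have "0 \<le> r ^ (2 ^ n) * (2 * M + 2)" using r0 M by simp
  then show "N (u (Suc n) - u n) \<le> (2 * N (u 0) + 2) * r ^ (2 ^ n)"
    using diff[OF le, of n] by (simp add: M_def algebra_simps)
qed

text \<open>
  The factor \<open>B ^ n\<close> will be the growth allowed by rapid decay, because the supports of the iterates
  grow exponentially in \<open>n\<close>. The ratio of consecutive terms is \<open>B * r ^ (2 ^ n)\<close>, which tends to \<open>0\<close>.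
\<close>

lemma summable_power_double_exponential:
  fixes B r :: real
  assumes "0 \<le> B" "0 \<le> r" "r < 1"
  shows "summable (\<lambda>n. B ^ n * r ^ (2 ^ n))"
proof -
  have "(\<lambda>n. r ^ (2 ^ n)) \<longlonglongrightarrow> 0"
    using LIMSEQ_subseq_LIMSEQ[OF LIMSEQ_realpow_zero[OF assms(2,3)], of "\<lambda>n. 2 ^ n"]
    by (simp add: o_def strict_mono_def)
  then have "(\<lambda>n. B * r ^ (2 ^ n)) \<longlonglongrightarrow> B * 0" by (intro tendsto_mult tendsto_const)
  then have "\<forall>\<^sub>F n in sequentially. B * r ^ (2 ^ n) < 1 / 2" by (intro order_tendstoD) auto
  then obtain n0 where n0: "\<And>n. n \<ge> n0 \<Longrightarrow> B * r ^ (2 ^ n) < 1 / 2"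
    by (auto simp: eventually_sequentially)
  show ?thesis
  proof (rule summable_ratio_test[of "1 / 2" n0])
    fix n assume n: "n0 \<le> n"
    have "B ^ Suc n * r ^ (2 ^ Suc n) = (B * r ^ (2 ^ n)) * (B ^ n * r ^ (2 ^ n))"
      by (simp add: mult_2 power_add)
    also have "\<dots> \<le> 1 / 2 * (B ^ n * r ^ (2 ^ n))"
      using n0[OF n] assms by (intro mult_right_mono) auto
    finally show "norm (B ^ Suc n * r ^ (2 ^ Suc n)) \<le> 1 / 2 * norm (B ^ n * r ^ (2 ^ n))"
      using assms by simp
  qed simp
qed

lemma poly_polynomial_growth:
  fixes P :: "real poly"
  obtains K D where "0 \<le> K" "\<And>x. 1 \<le> x \<Longrightarrow> \<bar>poly P x\<bar> \<le> K * x ^ D"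
proof -
  have "\<exists>K\<ge>0. \<exists>D. \<forall>x\<ge>1. \<bar>poly P x\<bar> \<le> K * x ^ D"
  proof (induction P)
    case (pCons a P)
    then obtain K D where K: "0 \<le> K" "\<And>x. 1 \<le> x \<Longrightarrow> \<bar>poly P x\<bar> \<le> K * x ^ D" by blast
    have "\<bar>poly (pCons a P) x\<bar> \<le> (\<bar>a\<bar> + K) * x ^ Suc D" if x: "1 \<le> x" for x
    proof -
      have "\<bar>poly (pCons a P) x\<bar> \<le> \<bar>a\<bar> * 1 + x * \<bar>poly P x\<bar>"
        using abs_triangle_ineq[of a "x * poly P x"] x by (simp add: abs_mult)
      also have "\<dots> \<le> \<bar>a\<bar> * x ^ Suc D + x * (K * x ^ D)"
        using x K(2)[OF x] one_le_power[OF x, of "Suc D"] by (intro add_mono mult_left_mono) auto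
      finally show ?thesis by (simp add: algebra_simps)
    qed
    with K(1) show ?case by (intro exI[of _ "\<bar>a\<bar> + K"] conjI exI[of _ "Suc D"]) auto
  qed (auto intro!: exI[of _ 0])
  with that show thesis by blast
qed

section \<open>Idempotents as limits of convolution operators\<close>

context group
begin

text \<open>
  Completeness of the reduced algebra, in the form needed here. The limit operator is defined
  coordinatewise; that it is bounded, and the limit in operator norm, follows from
  \<open>lp_bounded_limit\<close>. Idempotence is also checked coordinatewise: \<open>f n\<close> applied to \<open>F \<xi>\<close> converges to
  \<open>F (F \<xi>)\<close> by definition, and it differs from \<open>f n\<close> applied to \<open>\<xi>\<close> by a vanishing amount, because
  \<open>f n\<close> is nearly idempotent.
\<close>

lemma Cauchy_idempotent_limit:
  assumes p: "1 \<le> p" and f: "\<And>n. f n \<in> group_algebra G"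
    and sum: "summable (\<lambda>n. convolution_norm p G (\<lambda>\<gamma>. f (Suc n) \<gamma> - f n \<gamma>))"
    and idem: "(\<lambda>n. convolution_norm p G (\<lambda>\<gamma>. f n \<gamma> - convolution G (f n) (f n) \<gamma>)) \<longlonglongrightarrow> 0"
  obtains E where "E \<in> carrier (reduced_group_lp_algebra p G)"
    "E \<otimes>\<^bsub>reduced_group_lp_algebra p G\<^esub> E = E"
    "\<And>\<xi> \<alpha>. \<xi> \<in> lp_space p (carrier G) \<Longrightarrow> (\<lambda>n. convolution G (f n) \<xi> \<alpha>) \<longlonglongrightarrow> E \<xi> \<alpha>"
proof -
  let ?X = "carrier G" and ?N = "convolution_norm p G" and ?L = "lp_space p (carrier G)"
  let ?n = "lp_norm p (carrier G)"
  define s where "s = (\<lambda>n. ?N (\<lambda>\<gamma>. f (Suc n) \<gamma> - f n \<gamma>))"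
  \<comment> \<open>bounds the distance of \<open>f n\<close> to all later members of the sequence\<close>
  define t where "t = (\<lambda>n. \<Sum>k. s (k + n))"
  have diffCG: "(\<lambda>\<gamma>. f m \<gamma> - f n \<gamma>) \<in> group_algebra G" for m n by (intro group_algebra_diff f)
  have s0: "0 \<le> s n" for n unfolding s_def by (intro convolution_norm_nonneg diffCG p)
  have sums: "summable s" using sum by (simp add: s_def)
  have t0: "0 \<le> t n" for n unfolding t_def by (intro suminf_nonneg summable_ignore_initial_segment sums s0)
  have tlim: "t \<longlonglongrightarrow> 0"
    unfolding t_def using suminf_exist_split2[OF sums] by simp
  have tail: "?N (\<lambda>\<gamma>. f (n + k) \<gamma> - f n \<gamma>) \<le> t n" for n k
  proof -
    have "?N (\<lambda>\<gamma>. f (n + k) \<gamma> - f n \<gamma>) \<le> (\<Sum>i<k. s (i + n))"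
    proof (induction k)
      case 0
      have "?N (\<lambda>\<gamma>. 0) \<le> 0"
        using convolution_norm_scale[OF p group_algebra_zero, of 0] by simp
      then show ?case by simp
    next
      case (Suc k)
      have "?N (\<lambda>\<gamma>. (f (Suc (n + k)) \<gamma> - f (n + k) \<gamma>) + (f (n + k) \<gamma> - f n \<gamma>)) \<le> s (n + k) + ?N (\<lambda>\<gamma>. f (n + k) \<gamma> - f n \<gamma>)"
        unfolding s_def by (rule convolution_norm_add[OF p diffCG diffCG])
      with Suc show ?case by (simp add: add.commute)
    qed
    also have "\<dots> \<le> t n"
      unfolding t_def by (intro sum_le_suminf summable_ignore_initial_segment sums) (auto simp: s0)
    finally show ?thesis .
  qed
  define K where "K = t 0 + ?N (f 0)"
  have K0: "0 \<le> K" unfolding K_def by (intro add_nonneg_nonneg t0 convolution_norm_nonneg f p)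
  have NK: "?N (f n) \<le> K" for n
    using convolution_norm_add[OF p diffCG f, of n 0 0] tail[of 0 n] by (simp add: K_def)
  have n0: "0 \<le> ?n \<xi>" if "\<xi> \<in> ?L" for \<xi> by (rule lp_norm_nonneg[OF carrier_nonempty that])
  have bd: "lp_bounded p ?X (t n * ?n \<xi>) (\<lambda>\<alpha>. convolution G (f (n + k)) \<xi> \<alpha> - convolution G (f n) \<xi> \<alpha>)"
    if \<xi>: "\<xi> \<in> ?L" for n k \<xi>
  proof -
    have "lp_bounded p ?X (?N (\<lambda>\<gamma>. f (n + k) \<gamma> - f n \<gamma>) * ?n \<xi>) (convolution G (\<lambda>\<gamma>. f (n + k) \<gamma> - f n \<gamma>) \<xi>)"
      by (rule lp_bounded_convolution_norm[OF diffCG p n0[OF \<xi>] lp_bounded_norm[OF p carrier_nonempty \<xi>]])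
    then have "lp_bounded p ?X (t n * ?n \<xi>) (convolution G (\<lambda>\<gamma>. f (n + k) \<gamma> - f n \<gamma>) \<xi>)"
      by (rule lp_bounded_mono) (auto intro!: mult_right_mono mult_nonneg_nonneg tail n0 \<xi> convolution_norm_nonneg diffCG p)
    then show ?thesis by (simp add: convolution_diff_left f)
  qed
  have conv: "convergent (\<lambda>n. convolution G (f n) \<xi> \<alpha>)" if \<xi>: "\<xi> \<in> ?L" for \<xi> \<alpha>
  proof (rule Cauchy_convergent, rule metric_CauchyI)
    fix e :: real assume e: "0 < e"
    have "(\<lambda>n. t n * ?n \<xi>) \<longlonglongrightarrow> 0 * ?n \<xi>" by (intro tendsto_mult tlim tendsto_const)
    then have "\<forall>\<^sub>F n in sequentially. t n * ?n \<xi> < e / 2" using e by (intro order_tendstoD) auto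
    then obtain M where M: "t M * ?n \<xi> < e / 2" by (auto simp: eventually_sequentially)
    have "dist (convolution G (f n) \<xi> \<alpha>) (convolution G (f M) \<xi> \<alpha>) < e / 2" if "M \<le> n" for n
      using lp_bounded_coordinate[OF p _ bd[OF \<xi>, of M "n - M"], of \<alpha>] t0 n0[OF \<xi>] M that
      by (simp add: dist_norm)
    then have "dist (convolution G (f m) \<xi> \<alpha>) (convolution G (f n) \<xi> \<alpha>) < e" if "M \<le> m" "M \<le> n" for m n
      using that dist_triangle_half_l[of "convolution G (f m) \<xi> \<alpha>" "convolution G (f M) \<xi> \<alpha>" e] by blast
    then show "\<exists>M. \<forall>m\<ge>M. \<forall>n\<ge>M. dist (convolution G (f m) \<xi> \<alpha>) (convolution G (f n) \<xi> \<alpha>) < e" by blast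
  qed
  define F where "F \<xi> = (\<lambda>\<alpha>. lim (\<lambda>n. convolution G (f n) \<xi> \<alpha>))" for \<xi>
  have limF: "(\<lambda>n. convolution G (f n) \<xi> \<alpha>) \<longlonglongrightarrow> F \<xi> \<alpha>" if "\<xi> \<in> ?L" for \<xi> \<alpha>
    unfolding F_def using conv[OF that] by (simp add: convergent_LIMSEQ_iff)
  have F_out: "F \<xi> \<alpha> = 0" if "\<alpha> \<notin> ?X" for \<xi> \<alpha>
    using that by (simp add: F_def convolution_def)
  have F_diff: "lp_bounded p ?X (t n * ?n \<xi>) (\<lambda>\<alpha>. F \<xi> \<alpha> - convolution G (f n) \<xi> \<alpha>)" if \<xi>: "\<xi> \<in> ?L" for n \<xi>
  proof (rule lp_bounded_limit[OF _ p, where \<xi> = "\<lambda>k \<alpha>. convolution G (f (n + k)) \<xi> \<alpha> - convolution G (f n) \<xi> \<alpha>"])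
    show "0 \<le> t n * ?n \<xi>" using t0 n0[OF \<xi>] by simp
    show "(\<lambda>k. convolution G (f (n + k)) \<xi> \<alpha> - convolution G (f n) \<xi> \<alpha>) \<longlonglongrightarrow> F \<xi> \<alpha> - convolution G (f n) \<xi> \<alpha>" for \<alpha>
      using LIMSEQ_ignore_initial_segment[OF limF[OF \<xi>, of \<alpha>], of n]
      by (intro tendsto_diff tendsto_const) (simp add: add.commute)
    show "F \<xi> \<alpha> - convolution G (f n) \<xi> \<alpha> = 0" if "\<alpha> \<notin> ?X" for \<alpha>
      using that by (simp add: F_out convolution_outside)
    show "\<forall>\<^sub>F k in sequentially. lp_bounded p ?X (t n * ?n \<xi>)
        (\<lambda>\<alpha>. convolution G (f (n + k)) \<xi> \<alpha> - convolution G (f n) \<xi> \<alpha>)"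
      using bd[OF \<xi>] by simp
  qed
  have F_bd: "lp_bounded p ?X (K * ?n \<xi>) (F \<xi>)" if \<xi>: "\<xi> \<in> ?L" for \<xi>
  proof (rule lp_bounded_limit[OF _ p limF[OF \<xi>] F_out])
    show "0 \<le> K * ?n \<xi>" using K0 n0[OF \<xi>] by simp
    have "lp_bounded p ?X (K * ?n \<xi>) (convolution G (f n) \<xi>)" for n
      by (rule lp_bounded_mono[OF lp_bounded_convolution_norm[OF f p n0[OF \<xi>] lp_bounded_norm[OF p carrier_nonempty \<xi>]]])
        (auto intro!: mult_right_mono mult_nonneg_nonneg NK n0 \<xi> convolution_norm_nonneg f p)
    then show "\<forall>\<^sub>F n in sequentially. lp_bounded p ?X (K * ?n \<xi>) (convolution G (f n) \<xi>)" by simp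
  qed
  have F_lp: "F \<xi> \<in> ?L" if "\<xi> \<in> ?L" for \<xi>
    using F_bd[OF that] lp_bounded_iff[OF p carrier_nonempty, of "K * ?n \<xi>"] K0 n0[OF that] by simp
  define E where "E = restrict F ?L"
  have E_bounded: "E \<in> bounded_operators p ?X"
    unfolding E_def
  proof (rule bounded_operatorsI[OF p carrier_nonempty K0 F_bd])
    fix \<xi> \<eta> assume \<xi>: "\<xi> \<in> ?L" and \<eta>: "\<eta> \<in> ?L"
    show "F (\<lambda>x. \<xi> x + \<eta> x) = (\<lambda>x. F \<xi> x + F \<eta> x)"
    proof
      fix \<alpha>
      have "(\<lambda>n. convolution G (f n) (\<lambda>x. \<xi> x + \<eta> x) \<alpha>) \<longlonglongrightarrow> F \<xi> \<alpha> + F \<eta> \<alpha>"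
        unfolding convolution_add_right by (intro tendsto_add limF \<xi> \<eta>)
      then show "F (\<lambda>x. \<xi> x + \<eta> x) \<alpha> = F \<xi> \<alpha> + F \<eta> \<alpha>" unfolding F_def[of "\<lambda>x. \<xi> x + \<eta> x"] by (rule limI)
    qed
  next
    fix c \<xi> assume \<xi>: "\<xi> \<in> ?L"
    show "F (\<lambda>x. c * \<xi> x) = (\<lambda>x. c * F \<xi> x)"
    proof
      fix \<alpha>
      have "(\<lambda>n. convolution G (f n) (\<lambda>x. c * \<xi> x) \<alpha>) \<longlonglongrightarrow> c * F \<xi> \<alpha>"
        unfolding convolution_scale_right by (intro tendsto_mult tendsto_const limF \<xi>)
      then show "F (\<lambda>x. c * \<xi> x) \<alpha> = c * F \<xi> \<alpha>" unfolding F_def[of "\<lambda>x. c * \<xi> x"] by (rule limI)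
    qed
  qed
  show thesis
  proof (rule that[of E])
    show "(\<lambda>n. convolution G (f n) \<xi> \<alpha>) \<longlonglongrightarrow> E \<xi> \<alpha>" if "\<xi> \<in> ?L" for \<xi> \<alpha>
      using limF[OF that] that by (simp add: E_def)
    have "\<exists>g\<in>group_algebra G. operator_norm p ?X (\<lambda>\<xi>\<in>?L. \<lambda>\<alpha>. E \<xi> \<alpha> - regular_rep p G g \<xi> \<alpha>) < e" if e: "0 < e" for e
    proof -
      obtain n where n: "t n < e" using order_tendstoD(2)[OF tlim e] by (auto simp: eventually_sequentially)
      have "operator_norm p ?X (\<lambda>\<xi>\<in>?L. \<lambda>\<alpha>. E \<xi> \<alpha> - regular_rep p G (f n) \<xi> \<alpha>) \<le> t n"
        by (rule operator_norm_le[OF carrier_nonempty p t0]) (simp add: E_def regular_rep_eq F_diff)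
      then show ?thesis using n by (intro bexI[of _ "f n"] f) simp
    qed
    with E_bounded show "E \<in> carrier (reduced_group_lp_algebra p G)"
      by (simp add: reduced_group_lp_algebra_def)
    have "F (F \<xi>) = F \<xi>" if \<xi>: "\<xi> \<in> ?L" for \<xi>
    proof
      fix \<alpha>
      define d where "d n = ?N (\<lambda>\<gamma>. f n \<gamma> - convolution G (f n) (f n) \<gamma>)" for n
      have cc: "(\<lambda>\<gamma>. f n \<gamma> - convolution G (f n) (f n) \<gamma>) \<in> group_algebra G" for n
        by (intro group_algebra_diff convolution_group_algebra f)
      have d0: "0 \<le> d n" for n unfolding d_def by (intro convolution_norm_nonneg cc p)
      have est: "cmod (convolution G (f n) (F \<xi>) \<alpha> - convolution G (f n) \<xi> \<alpha>) \<le> K * (t n * ?n \<xi>) + d n * ?n \<xi>" for n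
      proof -
        let ?\<zeta> = "\<lambda>\<beta>. F \<xi> \<beta> - convolution G (f n) \<xi> \<beta>"
        have tn: "0 \<le> t n * ?n \<xi>" using t0 n0[OF \<xi>] by simp
        have 1: "lp_bounded p ?X (K * (t n * ?n \<xi>)) (convolution G (f n) ?\<zeta>)"
          by (rule lp_bounded_mono[OF lp_bounded_convolution_norm[OF f p tn F_diff[OF \<xi>]]])
            (auto intro!: mult_right_mono mult_nonneg_nonneg NK n0 \<xi> convolution_norm_nonneg f p t0)
        have 2: "lp_bounded p ?X (d n * ?n \<xi>) (convolution G (\<lambda>\<gamma>. f n \<gamma> - convolution G (f n) (f n) \<gamma>) \<xi>)"
          unfolding d_def by (rule lp_bounded_convolution_norm[OF cc p n0[OF \<xi>] lp_bounded_norm[OF p carrier_nonempty \<xi>]])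
        have "convolution G (f n) (F \<xi>) = (\<lambda>\<beta>. convolution G (f n) ?\<zeta> \<beta> + convolution G (f n) (convolution G (f n) \<xi>) \<beta>)"
          unfolding convolution_add_right[symmetric] by simp
        then have "convolution G (f n) (F \<xi>) \<alpha> - convolution G (f n) \<xi> \<alpha>
            = convolution G (f n) ?\<zeta> \<alpha> - convolution G (\<lambda>\<gamma>. f n \<gamma> - convolution G (f n) (f n) \<gamma>) \<xi> \<alpha>"
          by (simp add: convolution_diff_left f convolution_group_algebra convolution_assoc)
        also have "cmod \<dots> \<le> K * (t n * ?n \<xi>) + d n * ?n \<xi>"
          using lp_bounded_diff[OF p _ _ 1 2]
          by (rule lp_bounded_coordinate[OF p, rotated]) (use K0 tn d0 n0[OF \<xi>] in auto)
        finally show ?thesis .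
      qed
      have "(\<lambda>n. K * (t n * ?n \<xi>) + d n * ?n \<xi>) \<longlonglongrightarrow> K * (0 * ?n \<xi>) + 0 * ?n \<xi>"
        by (intro tendsto_add tendsto_mult tendsto_const tlim) (use idem in \<open>simp add: d_def\<close>)
      then have "(\<lambda>n. convolution G (f n) (F \<xi>) \<alpha> - convolution G (f n) \<xi> \<alpha>) \<longlonglongrightarrow> 0"
        by (intro Lim_null_comparison[OF always_eventually[OF allI[OF est]]]) simp
      moreover have "(\<lambda>n. convolution G (f n) (F \<xi>) \<alpha> - convolution G (f n) \<xi> \<alpha>) \<longlonglongrightarrow> F (F \<xi>) \<alpha> - F \<xi> \<alpha>"
        by (intro tendsto_diff limF F_lp \<xi>)
      ultimately have "F (F \<xi>) \<alpha> - F \<xi> \<alpha> = 0" by (rule LIMSEQ_unique[rotated])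
      then show "F (F \<xi>) \<alpha> = F \<xi> \<alpha>" by simp
    qed
    then show "E \<otimes>\<^bsub>reduced_group_lp_algebra p G\<^esub> E = E"
      by (auto simp: reduced_group_lp_algebra_def operator_algebra_def compose_def E_def F_lp)
  qed
qed

end

section \<open>Transfer between exponents by rapid decay\<close>

context group
begin

lemma finite_subset_length_ball:
  assumes "finite S" "S \<subseteq> carrier G"
  obtains m where "1 \<le> m" "S \<subseteq> length_ball G l m"
proof
  let ?m = "Suc (\<Sum>\<gamma>\<in>S. nat \<lceil>l \<gamma>\<rceil>)"
  show "S \<subseteq> length_ball G l ?m"
  proof
    fix \<gamma> assume \<gamma>: "\<gamma> \<in> S"
    have "nat \<lceil>l \<gamma>\<rceil> \<le> (\<Sum>\<gamma>\<in>S. nat \<lceil>l \<gamma>\<rceil>)" using assms \<gamma> by (intro member_le_sum) auto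
    then have "l \<gamma> \<le> real ?m" by linarith
    with \<gamma> assms show "\<gamma> \<in> length_ball G l ?m" by (auto simp: length_ball_def)
  qed
qed simp

text \<open>
  Rapid decay bounds the norm on \<open>\<ell>\<^sup>2\<close> by the \<open>\<ell>\<^sup>2\<close> norm of the coefficients, which in turn is at
  most the norm on \<open>\<ell>\<^sup>p\<close>. The loss is polynomial in the radius of the support, hence in the degree.
\<close>

lemma property_RD_poly_convolution:
  assumes "property_RD G" and b: "b \<in> group_algebra G"
  obtains K D where "0 \<le> K" "\<And>p q d. \<lbrakk>1 \<le> p; 1 \<le> d; degree q \<le> d\<rbrakk> \<Longrightarrow>
    convolution_norm 2 G (poly_convolution G b q) \<le> K * real d ^ D * convolution_norm p G (poly_convolution G b q)"
proof -
  obtain l P where l: "length_function G l"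
    and P: "\<And>n f. f \<in> group_algebra G \<Longrightarrow> {\<gamma>. f \<gamma> \<noteq> 0} \<subseteq> length_ball G l n \<Longrightarrow>
      convolution_norm 2 G f \<le> poly P (real n) * lp_norm 2 (carrier G) f"
    using assms(1) unfolding property_RD_def convolution_norm_def by blast
  obtain K D where K: "0 \<le> K" "\<And>x. 1 \<le> x \<Longrightarrow> \<bar>poly P x\<bar> \<le> K * x ^ D"
    using poly_polynomial_growth by blast
  obtain m where m: "1 \<le> m" "{\<gamma>. b \<gamma> \<noteq> 0} \<subseteq> length_ball G l m"
    using finite_subset_length_ball[OF group_algebra_finite[OF b] group_algebra_carrier[OF b]] by blast
  show thesis
  proof (rule that[of "K * real m ^ D"])
    show "0 \<le> K * real m ^ D" using K by simp
    fix p :: ennreal and q :: "complex poly" and d :: nat assume p: "1 \<le> p" and d: "1 \<le> d" "degree q \<le> d"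
    let ?f = "poly_convolution G b q"
    have f: "?f \<in> group_algebra G" by (rule poly_convolution_group_algebra[OF b])
    have "1 * 1 \<le> m * d" using m(1) d(1) by (rule mult_le_mono)
    then have md: "1 \<le> real (m * d)" by linarith
    have n0: "0 \<le> lp_norm 2 (carrier G) ?f"
      using lp_bounded_2_self[OF p f] convolution_norm_nonneg[OF f p]
      by (intro lp_norm_nonneg carrier_nonempty) (simp add: lp_bounded_iff carrier_nonempty)
    have "convolution_norm 2 G ?f \<le> poly P (real (m * d)) * lp_norm 2 (carrier G) ?f"
      by (rule P[OF f poly_convolution_support[OF b l m(2) d(2)]])
    also have "\<dots> \<le> (K * real (m * d) ^ D) * lp_norm 2 (carrier G) ?f"
      using K(2)[OF md] n0 by (intro mult_right_mono) auto
    also have "\<dots> \<le> (K * real (m * d) ^ D) * convolution_norm p G ?f"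
      using K(1) by (intro mult_left_mono lp_norm_2_le_convolution_norm p f) auto
    finally show "convolution_norm 2 G ?f \<le> K * real m ^ D * real d ^ D * convolution_norm p G ?f"
      by (simp add: power_mult_distrib mult.assoc)
  qed
qed

text \<open>
  The iteration is run with polynomials in \<open>b\<close> and the seminorm from \<open>\<ell>\<^sup>p\<close>. The \<open>n\<close>-th polynomial
  has degree at most \<open>3 ^ n\<close>, so passing to \<open>\<ell>\<^sup>2\<close> costs a factor that is exponential in \<open>n\<close>. The
  doubly exponential decay absorbs it, and the iterates also converge on \<open>\<ell>\<^sup>2\<close>.
\<close>

lemma approximate_idempotent_iterates:
  assumes RD: "property_RD G" and p: "1 \<le> p" and b: "b \<in> group_algebra G"
    and small: "7 * convolution_norm p G (\<lambda>\<gamma>. b \<gamma> - convolution G b b \<gamma>) \<le> 1 / (8 * (convolution_norm p G b + 1))"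
  obtains f where "\<And>n. f n \<in> group_algebra G"
    "\<And>n. convolution_norm p G (\<lambda>\<gamma>. f n \<gamma> - b \<gamma>) \<le> 1 / 8"
    "summable (\<lambda>n. convolution_norm 2 G (\<lambda>\<gamma>. f (Suc n) \<gamma> - f n \<gamma>))"
    "(\<lambda>n. convolution_norm 2 G (\<lambda>\<gamma>. f n \<gamma> - convolution G (f n) (f n) \<gamma>)) \<longlonglongrightarrow> 0"
proof -
  let ?e = "poly_convolution G b"
  define N where "N = (\<lambda>q. convolution_norm p G (?e q))"
  define u :: "nat \<Rightarrow> complex poly" where "u = rec_nat [:0, 1:] (\<lambda>n v. v * v * (3 - 2 * v))"
  define f where "f = (\<lambda>n. ?e (u n))"
  define r where "r = 1 / (8 * (N (u 0) + 1))"
  have u0: "u 0 = [:0, 1:]" and uSuc: "u (Suc n) = u n * u n * (3 - 2 * u n)" for n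
    by (simp_all add: u_def)
  have e0: "?e (u 0) = b" unfolding u0 by (rule poly_convolution_X[OF b])
  have eCG: "?e q \<in> group_algebra G" for q by (rule poly_convolution_group_algebra[OF b])
  have N0: "0 \<le> N q" for q unfolding N_def by (rule convolution_norm_nonneg[OF eCG p])
  have Nz: "N 0 = 0"
    using convolution_norm_scale[OF p group_algebra_zero, of 0] N0[of 0] by (simp add: N_def)
  have Nadd: "N (q + s) \<le> N q + N s" for q s
    unfolding N_def poly_convolution_add[OF b] by (rule convolution_norm_add[OF p eCG eCG])
  have Nmult: "N (q * s) \<le> N q * N s" for q s
    unfolding N_def poly_convolution_mult[OF b] by (rule convolution_norm_mult[OF p eCG eCG])
  have Nminus: "N (- q) \<le> N q" for q
    using convolution_norm_scale[OF p eCG, of "-1" q]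
    unfolding N_def poly_convolution_minus[OF b] by simp
  have None: "N 1 \<le> 1"
    unfolding N_def poly_convolution_1[OF b] by (rule convolution_norm_unit[OF p])
  have ec: "?e (q - q * q) = (\<lambda>\<gamma>. ?e q \<gamma> - convolution G (?e q) (?e q) \<gamma>)" for q
    by (simp add: poly_convolution_diff[OF b] poly_convolution_mult[OF b])
  have r7: "7 * N (u 0 - u 0 * u 0) \<le> r"
    using small unfolding r_def N_def ec e0 .
  note iter = idempotent_iteration[of N u r, OF N0 Nadd Nz Nmult Nminus None uSuc r7 r_def[THEN eq_refl]]
  have r0: "0 \<le> r" "r < 1" using N0[of "u 0"] by (auto simp: r_def divide_less_eq)
  have deg: "degree (u n) \<le> 3 ^ n" for n
  proof (induction n)
    case 0 show ?case by (simp add: u0)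
  next
    case (Suc n)
    have "degree (2 * u n) \<le> degree (2 :: complex poly) + degree (u n)" by (rule degree_mult_le)
    then have "degree (3 - 2 * u n) \<le> 3 ^ n" using Suc by (intro degree_diff_le) auto
    moreover have "degree (u (Suc n)) \<le> degree (u n) + degree (u n) + degree (3 - 2 * u n)"
      unfolding uSuc by (meson degree_mult_le add_mono order_refl order_trans)
    ultimately show ?case using Suc by simp
  qed
  have degc: "degree (u n - u n * u n) \<le> 3 ^ Suc n" for n
    using deg[of n] degree_mult_le[of "u n" "u n"] by (intro degree_diff_le) auto
  have degd: "degree (u (Suc n) - u n) \<le> 3 ^ Suc n" for n
    using deg[of n] deg[of "Suc n"] by (intro degree_diff_le) auto
  obtain K D where K: "0 \<le> K" "\<And>q d. \<lbrakk>1 \<le> d; degree q \<le> d\<rbrakk> \<Longrightarrow> convolution_norm 2 G (?e q) \<le> K * real d ^ D * N q"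
    using property_RD_poly_convolution[OF RD b] p unfolding N_def by metis
  define M where "M = 2 * N (u 0) + 2"
  have M: "1 \<le> M" using N0[of "u 0"] by (simp add: M_def)
  \<comment> \<open>the \<open>\<ell>\<^sup>p\<close> decay of the increments and defects, multiplied by the loss for degree \<open>3 ^ Suc n\<close>\<close>
  define h where "h = (\<lambda>n. K * 3 ^ D * M * ((3 ^ D) ^ n * r ^ (2 ^ n)))"
  have hsum: "summable h"
    unfolding h_def using r0 by (intro summable_mult summable_power_double_exponential) auto
  have bound: "convolution_norm 2 G (?e q) \<le> h n" if "degree q \<le> 3 ^ Suc n" "N q \<le> M * r ^ (2 ^ n)" for q n
  proof -
    have "convolution_norm 2 G (?e q) \<le> K * real (3 ^ Suc n) ^ D * N q"
      using that(1) by (intro K(2)) auto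
    also have "\<dots> \<le> K * real (3 ^ Suc n) ^ D * (M * r ^ (2 ^ n))"
      using that(2) K(1) by (intro mult_left_mono) auto
    also have "\<dots> = h n"
      by (simp add: h_def power_mult_distrib power_mult[symmetric] mult.commute[of n] algebra_simps)
    finally show ?thesis .
  qed
  have nn: "0 \<le> convolution_norm 2 G (?e q)" for q by (rule convolution_norm_nonneg[OF eCG]) simp
  show thesis
  proof (rule that[of f])
    show "f n \<in> group_algebra G" for n unfolding f_def by (rule eCG)
    show "convolution_norm p G (\<lambda>\<gamma>. f n \<gamma> - b \<gamma>) \<le> 1 / 8" for n
      using iter(2)[of n] unfolding N_def poly_convolution_diff[OF b] e0 f_def .
    have "convolution_norm 2 G (?e (u (Suc n) - u n)) \<le> h n" for n
      using iter(3)[of n] by (intro bound degd) (simp add: M_def)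
    then have "summable (\<lambda>n. convolution_norm 2 G (?e (u (Suc n) - u n)))"
      using nn by (intro summable_comparison_test'[OF hsum, of 0]) auto
    then show "summable (\<lambda>n. convolution_norm 2 G (\<lambda>\<gamma>. f (Suc n) \<gamma> - f n \<gamma>))"
      unfolding f_def poly_convolution_diff[OF b] .
    have "convolution_norm 2 G (?e (u n - u n * u n)) \<le> h n" for n
    proof (intro bound degc)
      have "N (u n - u n * u n) \<le> 7 * N (u n - u n * u n)" using N0 by simp
      also have "\<dots> \<le> 1 * r ^ (2 ^ n)" using iter(1)[of n] by simp
      also have "\<dots> \<le> M * r ^ (2 ^ n)" using M r0 by (intro mult_right_mono) auto
      finally show "N (u n - u n * u n) \<le> M * r ^ (2 ^ n)" .
    qed
    then have "(\<lambda>n. convolution_norm 2 G (?e (u n - u n * u n))) \<longlonglongrightarrow> 0"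
      using nn by (intro tendsto_sandwich[OF _ _ tendsto_const summable_LIMSEQ_zero[OF hsum]] always_eventually) auto
    then show "(\<lambda>n. convolution_norm 2 G (\<lambda>\<gamma>. f n \<gamma> - convolution G (f n) (f n) \<gamma>)) \<longlonglongrightarrow> 0"
      unfolding f_def ec .
  qed
qed

text \<open>
  The limit of the iterates on \<open>\<ell>\<^sup>2\<close> is an idempotent of the reduced \<open>C\<^sup>*\<close>-algebra, hence \<open>0\<close> or the
  unit. Evaluated at the unit mass, this says that the coefficients of the iterates converge pointwise
  to those of \<open>0\<close> or of the unit mass. The iterates stay near \<open>b\<close> in the norm of \<open>\<ell>\<^sup>p\<close>, and by
  lower semicontinuity so does their pointwise limit.
\<close>

lemma approximate_idempotent_trivial:
  assumes RD: "property_RD G"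
    and triv: "\<nexists>a. nontrivial_idempotent (reduced_group_Cstar_algebra G) a"
    and p: "1 \<le> p" and b: "b \<in> group_algebra G"
    and small: "7 * convolution_norm p G (\<lambda>\<gamma>. b \<gamma> - convolution G b b \<gamma>) \<le> 1 / (8 * (convolution_norm p G b + 1))"
  obtains "convolution_norm p G b \<le> 1 / 8"
    | "convolution_norm p G (\<lambda>\<gamma>. b \<gamma> - unit_mass G \<gamma>) \<le> 1 / 8"
proof -
  let ?A = "reduced_group_lp_algebra 2 G" and ?L = "lp_space 2 (carrier G)"
  obtain f where f: "\<And>n. f n \<in> group_algebra G"
    "\<And>n. convolution_norm p G (\<lambda>\<gamma>. f n \<gamma> - b \<gamma>) \<le> 1 / 8"
    "summable (\<lambda>n. convolution_norm 2 G (\<lambda>\<gamma>. f (Suc n) \<gamma> - f n \<gamma>))"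
    "(\<lambda>n. convolution_norm 2 G (\<lambda>\<gamma>. f n \<gamma> - convolution G (f n) (f n) \<gamma>)) \<longlonglongrightarrow> 0"
    using approximate_idempotent_iterates[OF RD p b small] by blast
  obtain E where E: "E \<in> carrier ?A" "E \<otimes>\<^bsub>?A\<^esub> E = E"
    "\<And>\<xi> \<alpha>. \<xi> \<in> ?L \<Longrightarrow> (\<lambda>n. convolution G (f n) \<xi> \<alpha>) \<longlonglongrightarrow> E \<xi> \<alpha>"
    using Cauchy_idempotent_limit[OF _ f(1,3,4)] by auto
  have \<delta>: "unit_mass G \<in> ?L"
    using lp_bounded_unit_mass[of 2] lp_bounded_iff[of 2 "carrier G" 1 "unit_mass G"] carrier_nonempty by simp
  have lim: "(\<lambda>n. f n \<alpha>) \<longlonglongrightarrow> E (unit_mass G) \<alpha>" for \<alpha>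
    using E(3)[OF \<delta>, of \<alpha>] by (simp add: convolution_unit_right f(1))
  have near: "convolution_norm p G (\<lambda>\<gamma>. b \<gamma> - g \<gamma>) \<le> 1 / 8"
    if g: "g \<in> group_algebra G" "E (unit_mass G) = g" for g
  proof (rule convolution_norm_limit[OF p, of _ "\<lambda>n \<gamma>. b \<gamma> - f n \<gamma>"])
    show "convolution_norm p G (\<lambda>\<gamma>. b \<gamma> - f n \<gamma>) \<le> 1 / 8" for n
      using convolution_norm_scale[OF p group_algebra_diff[OF f(1) b], of "-1" n] f(2)[of n] by simp
    show "(\<lambda>n. b \<gamma> - f n \<gamma>) \<longlonglongrightarrow> b \<gamma> - g \<gamma>" for \<gamma>
      using lim[of \<gamma>] g(2) by (intro tendsto_diff tendsto_const) simp
  qed (auto intro!: group_algebra_diff b f g)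
  have "E = \<zero>\<^bsub>?A\<^esub> \<or> E = \<one>\<^bsub>?A\<^esub>"
    using triv E(1,2) by (auto simp: nontrivial_idempotent_def reduced_group_Cstar_algebra_def)
  then have "E (unit_mass G) = (\<lambda>\<gamma>. 0) \<or> E (unit_mass G) = unit_mass G"
    using \<delta> by (auto simp: reduced_group_lp_algebra_def operator_algebra_def)
  then show thesis
  proof
    assume "E (unit_mass G) = (\<lambda>\<gamma>. 0)"
    from near[OF group_algebra_zero this] show thesis by (intro that(1)) simp
  next
    assume "E (unit_mass G) = unit_mass G"
    from near[OF unit_mass_group_algebra this] show thesis by (rule that(2))
  qed
qed

end

text \<open>
  An element \<open>b\<close> of the group algebra close to the idempotent \<open>a\<close> is nearly idempotent, so it is near
  \<open>0\<close> or near the unit. Then \<open>a\<close> is at distance less than \<open>1\<close> from \<open>0\<close> or from the unit, and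
  \<open>contraction_fixed_vector_zero\<close> applies to the range of \<open>a\<close> or to the range of its complement.
\<close>

lemma (in group) idempotent_trivial:
  assumes RD: "property_RD G"
    and triv: "\<nexists>a. nontrivial_idempotent (reduced_group_Cstar_algebra G) a"
    and p: "1 \<le> p"
    and a: "a \<in> carrier (reduced_group_lp_algebra p G)"
    and idem: "a \<otimes>\<^bsub>reduced_group_lp_algebra p G\<^esub> a = a"
  shows "a = \<zero>\<^bsub>reduced_group_lp_algebra p G\<^esub> \<or> a = \<one>\<^bsub>reduced_group_lp_algebra p G\<^esub>"
proof -
  let ?X = "carrier G" and ?L = "lp_space p (carrier G)" and ?n = "lp_norm p (carrier G)"
  let ?N = "convolution_norm p G"
  note ne = carrier_nonempty
  have ab: "a \<in> bounded_operators p ?X"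
    and dense: "\<And>\<epsilon>. 0 < \<epsilon> \<Longrightarrow> \<exists>f\<in>group_algebra G. operator_norm p ?X (\<lambda>\<xi>\<in>?L. \<lambda>\<alpha>. a \<xi> \<alpha> - regular_rep p G f \<xi> \<alpha>) < \<epsilon>"
    using a by (auto simp: reduced_group_lp_algebra_def)
  have aL: "a \<xi> \<in> ?L" if "\<xi> \<in> ?L" for \<xi> using bounded_operators_memD[OF ab that] .
  have aext: "a \<in> extensional ?L" using ab by (auto simp: bounded_operators_def PiE_def)
  have aa: "a (a \<xi>) = a \<xi>" if "\<xi> \<in> ?L" for \<xi>
    using fun_cong[OF idem, of \<xi>] that by (simp add: reduced_group_lp_algebra_def operator_algebra_def compose_def)
  define A where "A = operator_norm p ?X a"
  have A: "0 \<le> A" unfolding A_def by (rule operator_norm_nonneg[OF ab ne p])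
  \<comment> \<open>chosen so that the defect of \<open>b\<close>, which is at most \<open>2 (A + 2) \<epsilon>\<close>, starts the iteration:
    \<open>7 * 2 (A + 2) \<epsilon> = 1 / (8 (A + 2))\<close>, and \<open>A + 2\<close> bounds \<open>?N b + 1\<close>\<close>
  define \<epsilon> where "\<epsilon> = 1 / (112 * (A + 2)\<^sup>2)"
  have A2: "4 \<le> (A + 2)\<^sup>2" using A power_mono[of 2 "A + 2" 2] by simp
  have "\<epsilon> \<le> 1 / (112 * 4)" unfolding \<epsilon>_def using A2 by (intro divide_left_mono mult_left_mono) auto
  then have \<epsilon>: "0 < \<epsilon>" "\<epsilon> \<le> 1 / 8" using A by (auto simp: \<epsilon>_def)
  obtain b where b: "b \<in> group_algebra G"
    and close: "operator_norm p ?X (\<lambda>\<xi>\<in>?L. \<lambda>\<alpha>. a \<xi> \<alpha> - regular_rep p G b \<xi> \<alpha>) < \<epsilon>"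
    using dense[OF \<epsilon>(1)] by blast
  define T where "T = (\<lambda>\<xi>\<in>?L. \<lambda>\<alpha>. a \<xi> \<alpha> - regular_rep p G b \<xi> \<alpha>)"
  have T: "T \<in> bounded_operators p ?X"
    unfolding T_def
  proof (rule bounded_operatorsI[OF p ne, of "A + ?N b"])
    have Nb: "0 \<le> ?N b" by (rule convolution_norm_nonneg[OF b p])
    then show "0 \<le> A + ?N b" using A by simp
    fix \<xi> assume \<xi>: "\<xi> \<in> ?L"
    have n0: "0 \<le> ?n \<xi>" by (rule lp_norm_nonneg[OF ne \<xi>])
    have "lp_bounded p ?X (A * ?n \<xi> + ?N b * ?n \<xi>) (\<lambda>\<alpha>. a \<xi> \<alpha> - convolution G b \<xi> \<alpha>)"
      using A Nb n0 unfolding A_def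
      by (intro lp_bounded_diff p lp_bounded_operator_norm lp_bounded_convolution_norm
          ab ne b lp_bounded_norm \<xi> mult_nonneg_nonneg)
    then show "lp_bounded p ?X ((A + ?N b) * ?n \<xi>) (\<lambda>\<alpha>. a \<xi> \<alpha> - regular_rep p G b \<xi> \<alpha>)"
      by (simp add: regular_rep_eq \<xi> distrib_right)
    show "(\<lambda>\<alpha>. a (\<lambda>x. c * \<xi> x) \<alpha> - regular_rep p G b (\<lambda>x. c * \<xi> x) \<alpha>) = (\<lambda>x. c * (a \<xi> x - regular_rep p G b \<xi> x))" for c
      by (simp add: bounded_operators_scale[OF ab \<xi>] regular_rep_eq \<xi> lp_space_scale ne p convolution_scale_right right_diff_distrib)
    fix \<eta> assume \<eta>: "\<eta> \<in> ?L"
    show "(\<lambda>\<alpha>. a (\<lambda>x. \<xi> x + \<eta> x) \<alpha> - regular_rep p G b (\<lambda>x. \<xi> x + \<eta> x) \<alpha>)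
        = (\<lambda>x. a \<xi> x - regular_rep p G b \<xi> x + (a \<eta> x - regular_rep p G b \<eta> x))"
      by (simp add: bounded_operators_add[OF ab \<xi> \<eta>] regular_rep_eq \<xi> \<eta> lp_space_add ne p convolution_add_right, simp add: algebra_simps)
  qed
  have Tle: "operator_norm p ?X T \<le> \<epsilon>" using close by (simp add: T_def)
  have T0: "0 \<le> operator_norm p ?X T" by (rule operator_norm_nonneg[OF T ne p])
  have diff: "lp_bounded p ?X (\<epsilon> * C) (\<lambda>\<alpha>. a \<xi> \<alpha> - convolution G b \<xi> \<alpha>)"
    if "0 \<le> C" "lp_bounded p ?X C \<xi>" for C \<xi>
  proof -
    have \<xi>: "\<xi> \<in> ?L" using that lp_bounded_iff[OF p ne] by blast
    have "lp_bounded p ?X (operator_norm p ?X T * C) (T \<xi>)"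
      by (rule lp_bounded_operator_norm[OF T ne p that])
    then have "lp_bounded p ?X (\<epsilon> * C) (T \<xi>)"
      by (rule lp_bounded_mono) (use T0 Tle that in \<open>auto intro!: mult_right_mono\<close>)
    then show ?thesis by (simp add: T_def \<xi> regular_rep_eq)
  qed
  have abd: "lp_bounded p ?X (A * C) (a \<xi>)" if "0 \<le> C" "lp_bounded p ?X C \<xi>" for C \<xi>
    unfolding A_def by (rule lp_bounded_operator_norm[OF ab ne p that])
  have Nb: "?N b \<le> A + \<epsilon>"
  proof (rule convolution_norm_le[OF p])
    fix \<xi> C assume C: "0 \<le> C" and \<xi>: "lp_bounded p ?X C \<xi>"
    have "lp_bounded p ?X (A * C + \<epsilon> * C) (\<lambda>\<alpha>. a \<xi> \<alpha> - (a \<xi> \<alpha> - convolution G b \<xi> \<alpha>))"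
      using A \<epsilon> C by (intro lp_bounded_diff p abd diff \<xi> mult_nonneg_nonneg) auto
    then show "lp_bounded p ?X ((A + \<epsilon>) * C) (convolution G b \<xi>)" by (simp add: distrib_right)
  qed (use A \<epsilon> in auto)
  have Nb0: "0 \<le> ?N b" by (rule convolution_norm_nonneg[OF b p])
  have Nc: "?N (\<lambda>\<gamma>. b \<gamma> - convolution G b b \<gamma>) \<le> \<epsilon> + ?N b * \<epsilon> + \<epsilon> * A"
  proof (rule convolution_norm_le[OF p])
    fix \<xi> C assume C: "0 \<le> C" and \<xi>: "lp_bounded p ?X C \<xi>"
    have \<xi>L: "\<xi> \<in> ?L" using lp_bounded_iff[OF p ne C] \<xi> by blast
    let ?\<zeta> = "\<lambda>\<alpha>. a \<xi> \<alpha> - convolution G b \<xi> \<alpha>"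
    \<comment> \<open>as \<open>a (a \<xi>) = a \<xi>\<close>, the defect of \<open>b\<close> is a combination of three differences \<open>a - b\<close>\<close>
    have "convolution G b (\<lambda>\<alpha>. ?\<zeta> \<alpha> + convolution G b \<xi> \<alpha>) = (\<lambda>\<alpha>. convolution G b ?\<zeta> \<alpha> + convolution G b (convolution G b \<xi>) \<alpha>)"
      by (rule convolution_add_right)
    then have e: "convolution G b (a \<xi>) = (\<lambda>\<alpha>. convolution G b ?\<zeta> \<alpha> + convolution G b (convolution G b \<xi>) \<alpha>)" by simp
    have "lp_bounded p ?X (?N b * (\<epsilon> * C) + \<epsilon> * (A * C) + \<epsilon> * C)
        (\<lambda>\<alpha>. convolution G b ?\<zeta> \<alpha> + (a (a \<xi>) \<alpha> - convolution G b (a \<xi>) \<alpha>) - ?\<zeta> \<alpha>)"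
      using A \<epsilon> C Nb0
      by (intro lp_bounded_diff[OF p _ _ lp_bounded_add[OF p]] lp_bounded_convolution_norm[OF b p]
          diff abd \<xi> mult_nonneg_nonneg add_nonneg_nonneg) auto
    moreover have "(\<lambda>\<alpha>. convolution G b ?\<zeta> \<alpha> + (a (a \<xi>) \<alpha> - convolution G b (a \<xi>) \<alpha>) - ?\<zeta> \<alpha>)
      = convolution G (\<lambda>\<gamma>. b \<gamma> - convolution G b b \<gamma>) \<xi>"
      unfolding aa[OF \<xi>L] e
      by (simp add: convolution_diff_left convolution_assoc convolution_group_algebra b)
    ultimately show "lp_bounded p ?X ((\<epsilon> + ?N b * \<epsilon> + \<epsilon> * A) * C) (convolution G (\<lambda>\<gamma>. b \<gamma> - convolution G b b \<gamma>) \<xi>)"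
      by (simp add: algebra_simps)
  qed (use A \<epsilon> Nb0 in auto)
  have small: "7 * ?N (\<lambda>\<gamma>. b \<gamma> - convolution G b b \<gamma>) \<le> 1 / (8 * (?N b + 1))"
  proof -
    have "\<epsilon> + ?N b * \<epsilon> + \<epsilon> * A \<le> \<epsilon> * (2 * (A + 2))"
    proof -
      have "?N b * \<epsilon> \<le> (A + 1) * \<epsilon>" using Nb \<epsilon> by (intro mult_right_mono) auto
      moreover have "0 \<le> \<epsilon> * A" using \<epsilon> A by simp
      ultimately show ?thesis using \<epsilon> by (simp add: algebra_simps)
    qed
    then have "7 * ?N (\<lambda>\<gamma>. b \<gamma> - convolution G b b \<gamma>) \<le> 7 * (\<epsilon> * (2 * (A + 2)))"
      using Nc by linarith
    also have "\<dots> = 14 * (A + 2) * \<epsilon>" by simp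
    also have "\<dots> = 1 / (8 * (A + 2))"
      using A by (simp add: \<epsilon>_def power2_eq_square divide_simps) (simp add: algebra_simps)?
    also have "\<dots> \<le> 1 / (8 * (?N b + 1))" using Nb Nb0 \<epsilon> by (intro divide_left_mono) auto
    finally show ?thesis .
  qed
  have \<theta>: "0 \<le> \<epsilon> + 1 / 8" "\<epsilon> + 1 / 8 < 1" using \<epsilon> by auto
  consider "?N b \<le> 1 / 8" | "?N (\<lambda>\<gamma>. b \<gamma> - unit_mass G \<gamma>) \<le> 1 / 8"
    using approximate_idempotent_trivial[OF RD triv p b small] by blast
  then show ?thesis
  proof cases
    case 1
    have "a \<xi> = (\<lambda>x. 0)" if \<xi>: "\<xi> \<in> ?L" for \<xi>
    proof (rule contraction_fixed_vector_zero[OF p ne aL[OF \<xi>] \<theta>(2) _ \<theta>(1)])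
      have n0: "0 \<le> ?n (a \<xi>)" and nb: "lp_bounded p ?X (?n (a \<xi>)) (a \<xi>)"
        by (rule lp_norm_nonneg[OF ne aL[OF \<xi>]], rule lp_bounded_norm[OF p ne aL[OF \<xi>]])
      have "lp_bounded p ?X (1 / 8 * ?n (a \<xi>)) (convolution G b (a \<xi>))"
        by (rule lp_bounded_mono[OF lp_bounded_convolution_norm[OF b p n0 nb]])
          (use mult_right_mono[OF 1 n0] n0 Nb0 in auto)
      then have "lp_bounded p ?X (\<epsilon> * ?n (a \<xi>) + 1 / 8 * ?n (a \<xi>))
          (\<lambda>\<alpha>. (a (a \<xi>) \<alpha> - convolution G b (a \<xi>) \<alpha>) + convolution G b (a \<xi>) \<alpha>)"
        using n0 \<epsilon> by (intro lp_bounded_add p diff nb) auto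
      then show "lp_bounded p ?X ((\<epsilon> + 1 / 8) * ?n (a \<xi>)) (a \<xi>)"
        by (simp add: aa \<xi> distrib_right)
    qed
    then have "a = \<zero>\<^bsub>reduced_group_lp_algebra p G\<^esub>"
      using aext by (auto simp: reduced_group_lp_algebra_def operator_algebra_def extensional_def)
    then show ?thesis ..
  next
    case 2
    have "a \<xi> = \<xi>" if \<xi>: "\<xi> \<in> ?L" for \<xi>
    proof -
      let ?\<eta> = "\<lambda>\<alpha>. a \<xi> \<alpha> - \<xi> \<alpha>"
      have \<eta>: "?\<eta> \<in> ?L" by (rule lp_space_diff[OF ne p aL[OF \<xi>] \<xi>])
      have "?\<eta> = (\<lambda>x. 0)"
      proof (rule contraction_fixed_vector_zero[OF p ne \<eta> \<theta>(2) _ \<theta>(1)])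
        have n0: "0 \<le> ?n ?\<eta>" and nb: "lp_bounded p ?X (?n ?\<eta>) ?\<eta>"
          by (rule lp_norm_nonneg[OF ne \<eta>], rule lp_bounded_norm[OF p ne \<eta>])
        have c: "(\<lambda>\<gamma>. b \<gamma> - unit_mass G \<gamma>) \<in> group_algebra G"
          by (rule group_algebra_diff[OF b unit_mass_group_algebra])
        have "lp_bounded p ?X (1 / 8 * ?n ?\<eta>) (convolution G (\<lambda>\<gamma>. b \<gamma> - unit_mass G \<gamma>) ?\<eta>)"
          by (rule lp_bounded_mono[OF lp_bounded_convolution_norm[OF c p n0 nb]])
            (use mult_right_mono[OF 2 n0] n0 convolution_norm_nonneg[OF c p] in auto)
        moreover have "convolution G (\<lambda>\<gamma>. b \<gamma> - unit_mass G \<gamma>) ?\<eta> = (\<lambda>\<alpha>. convolution G b ?\<eta> \<alpha> - ?\<eta> \<alpha>)"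
          using lp_bounded_outside[OF nb] by (simp add: convolution_diff_left b unit_mass_group_algebra convolution_unit_left)
        moreover have "a ?\<eta> = (\<lambda>x. 0)"
          using bounded_operators_diff[OF ne p ab aL[OF \<xi>] \<xi>] by (simp add: aa \<xi>)
        ultimately have "lp_bounded p ?X (1 / 8 * ?n ?\<eta> + \<epsilon> * ?n ?\<eta>)
            (\<lambda>\<alpha>. (convolution G b ?\<eta> \<alpha> - ?\<eta> \<alpha>) + (a ?\<eta> \<alpha> - convolution G b ?\<eta> \<alpha>))"
          using n0 \<epsilon> by (intro lp_bounded_add p diff nb) auto
        then have "lp_bounded p ?X ((\<epsilon> + 1 / 8) * ?n ?\<eta>) (\<lambda>\<alpha>. - ?\<eta> \<alpha>)"
          unfolding \<open>a ?\<eta> = (\<lambda>x. 0)\<close> by (simp add: algebra_simps)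
        then show "lp_bounded p ?X ((\<epsilon> + 1 / 8) * ?n ?\<eta>) ?\<eta>"
          by (rule lp_bounded_dominated) (simp only: norm_minus_cancel order_refl)
      qed
      then show ?thesis by (simp add: fun_eq_iff)
    qed
    then have "a = \<one>\<^bsub>reduced_group_lp_algebra p G\<^esub>"
      using aext by (auto simp: reduced_group_lp_algebra_def operator_algebra_def extensional_def)
    then show ?thesis ..
  qed
qed

theorem corollary3:
  fixes \<Gamma> :: "('g, 'm) monoid_scheme"
  assumes "group \<Gamma>"
    and "property_RD \<Gamma>"
    and "\<nexists>a. nontrivial_idempotent (reduced_group_Cstar_algebra \<Gamma>) a"
  shows "\<forall>p::ennreal. 1 \<le> p \<longrightarrow> (\<nexists>a. nontrivial_idempotent (reduced_group_lp_algebra p \<Gamma>) a)"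
  using group.idempotent_trivial[OF assms] unfolding nontrivial_idempotent_def by blast

end
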